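(* Let $k\ge 2$ be an integer. Then the domain $\mathbb{H}_k = \{(z_1,z_2)\in\mathbb{C}^2 : |z_1|^k < |z_2| < 1\}$ is not a Lu Qi-Keng domain.
   Context: For a domain $\Omega\subset\mathbb{C}^n$, the Bergman space $A^2(\Omega)$ is the Hilbert space of holomorphic functions on $\Omega$ that are square-integrable with respect to Lebesgue measure $dV$. The Bergman kernel of $\Omega$ is the function $\mathbb{B}_\Omega:\Omega\times\Omega\to\mathbb{C}$, given by the Riesz representation theorem, such that $\overline{\mathbb{B}_\Omega(z,\cdot)}\in A^2(\Omega)$ for each $z\in\Omega$ and $f(z)=\int_\Omega \mathbb{B}_\Omega(z,w)f(w)\,dV(w)$ for all $f\in A^2(\Omega)$, $z\in\Omega$. A domain $\Omega$ is called Lu Qi-Keng if its Bergman kernel is zero-free, i.e. $\mathbb{B}_\Omega(z,w)\neq 0$ for all $z,w\in\Omega$. *)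

theory Defs
  imports "HOL-Analysis.Analysis"
begin

text \<open>Holomorphy in several variables is complex Frechet differentiability: the real derivative
  exists at every point and is complex linear. It is only meant for open \<open>\<Omega>\<close>.\<close>

definition holomorphic_Cn :: "(complex ^ 'n \<Rightarrow> complex) \<Rightarrow> (complex ^ 'n) set \<Rightarrow> bool"
  where "holomorphic_Cn f \<Omega> \<longleftrightarrow>
    (\<forall>z\<in>\<Omega>. \<exists>L. (f has_derivative L) (at z) \<and> (\<forall>c v. L (c *s v) = c * L v))"

text \<open>Elements of the Bergman space are total functions; their values outside \<open>\<Omega>\<close> are
  irrelevant.\<close>

definition bergman_space :: "(complex ^ 'n) set \<Rightarrow> (complex ^ 'n \<Rightarrow> complex) set"
  where "bergman_space \<Omega> =
    {f. holomorphic_Cn f \<Omega> \<and> set_integrable lebesgue \<Omega> (\<lambda>z. (cmod (f z))\<^sup>2)}"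

text \<open>For \<open>z \<in> \<Omega>\<close>, \<open>bergman_kernel \<Omega> z\<close> is the function representing evaluation at \<open>z\<close>. Requiring
  it to vanish outside \<open>\<Omega>\<close> makes it unique as a total function.\<close>

definition bergman_kernel :: "(complex ^ 'n) set \<Rightarrow> complex ^ 'n \<Rightarrow> complex ^ 'n \<Rightarrow> complex"
  where "bergman_kernel \<Omega> z = (THE g.
    (\<lambda>w. cnj (g w)) \<in> bergman_space \<Omega> \<and>
    (\<forall>f\<in>bergman_space \<Omega>. f z = (LINT w:\<Omega>|lebesgue. g w * f w)) \<and>
    (\<forall>w. w \<notin> \<Omega> \<longrightarrow> g w = 0))"

definition lu_qi_keng :: "(complex ^ 'n) set \<Rightarrow> bool"
  where "lu_qi_keng \<Omega> \<longleftrightarrow> (\<forall>z\<in>\<Omega>. \<forall>w\<in>\<Omega>. bergman_kernel \<Omega> z w \<noteq> 0)"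

definition hartogs_domain :: "nat \<Rightarrow> (complex ^ 2) set"
  where "hartogs_domain k = {z. cmod (z $ 1) ^ k < cmod (z $ 2) \<and> cmod (z $ 2) < 1}"

lemma open_hartogs_domain: "open (hartogs_domain k)"
  unfolding hartogs_domain_def Collect_conj_eq
  by (intro open_Int open_Collect_less continuous_intros)

lemma hartogs_domain_nonempty:
  assumes "k > 0"
  shows "hartogs_domain k \<noteq> {}"
proof -
  have "vector [0, 1/2] \<in> hartogs_domain k"
    using assms by (simp add: hartogs_domain_def zero_power)
  then show ?thesis by blast
qed

lemma connected_hartogs_domain:
  assumes k: "k > 0"
  shows "connected (hartogs_domain k)"
proof -
  define F :: "complex \<times> complex \<Rightarrow> complex ^ 2" where
    "F = (\<lambda>(u, v). \<chi> i. if i = 1 then u * of_real (root k (cmod v)) else v)"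
  let ?S = "ball (0::complex) 1 \<times> (ball (0::complex) 1 - {0})"
  have cont: "continuous_on ?S F"
    unfolding F_def split_def
  proof (rule continuous_on_vec_lambda)
    fix i :: 2
    show "continuous_on ?S
      (\<lambda>x. if i = 1 then fst x * complex_of_real (root k (cmod (snd x))) else snd x)"
      by (cases "i = 1") (auto intro!: continuous_intros)
  qed
  have conn: "connected ?S"
    by (intro connected_Times convex_connected convex_ball connected_open_delete) simp_all
  have "F ` ?S = hartogs_domain k"
  proof (intro equalityI subsetI)
    fix z assume "z \<in> F ` ?S"
    then obtain u v where z: "z = F (u, v)" and u: "cmod u < 1" and v: "v \<noteq> 0" "cmod v < 1"
      by (fastforce simp: image_iff)
    have "cmod (u * of_real (root k (cmod v))) ^ k = cmod u ^ k * cmod v"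
      using k by (simp add: norm_mult power_mult_distrib real_root_pow_pos2 real_root_ge_zero)
    also have "\<dots> < 1 * cmod v"
      using u v k by (intro mult_strict_right_mono) (simp_all add: power_less_one_iff)
    finally show "z \<in> hartogs_domain k"
      using v by (simp add: z F_def hartogs_domain_def)
  next
    fix z assume "z \<in> hartogs_domain k"
    then have z: "cmod (z $ 1) ^ k < cmod (z $ 2)" "cmod (z $ 2) < 1"
      by (auto simp: hartogs_domain_def)
    have pos: "0 < cmod (z $ 2)"
      using z(1) by (meson le_less_trans norm_ge_zero zero_le_power)
    define r where "r = root k (cmod (z $ 2))"
    have r: "r > 0" "r ^ k = cmod (z $ 2)"
      using pos k by (simp_all add: r_def)
    have "cmod (z $ 1) < r"
      using z(1) r by (metis less_eq_real_def power_less_imp_less_base)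
    then have "(z $ 1 / of_real r, z $ 2) \<in> ?S"
      using r pos z(2) by (auto simp: norm_divide)
    moreover have "F (z $ 1 / of_real r, z $ 2) = z"
      using r(1) by (auto simp: F_def vec_eq_iff forall_2 simp flip: r_def)
    ultimately show "z \<in> F ` ?S"
      by (metis image_eqI)
  qed
  then show ?thesis
    using connected_continuous_image[OF cont conn] by simp
qed

end

theory Submission imports Defs "HOL-Complex_Analysis.Conformal_Mappings" begin

text \<open>
The map \<open>T (a, b) = (a b, b ^ k)\<close> is a \<open>k\<close>-sheeted holomorphic covering of the Hartogs domain by the
product of the unit disc and the punctured unit disc. Its deck transformations are
\<open>(a, b) \<mapsto> (a / \<omega>, b \<omega>)\<close> with \<open>\<omega> ^ k = 1\<close>, and its complex Jacobian is \<open>k b ^ k\<close>. If \<open>f\<close> lies in the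
Bergman space of the Hartogs domain, then \<open>F (a, b) = b ^ k f (T (a, b))\<close> is holomorphic and square
integrable on the punctured bidisc. Square integrable functions extend across the puncture, so \<open>F\<close> is
reproduced by the Bergman kernel of the bidisc, which is the product of the kernels
\<open>1 / (\<pi> (1 - u cnj a)\<^sup>2)\<close> and \<open>1 / (\<pi> (1 - v cnj b)\<^sup>2)\<close>. As \<open>F\<close> is invariant under the deck group, the average of
the kernel over this group reproduces \<open>F\<close> as well, and the average descends to the Hartogs domain.
This gives the explicit formula (\<open>bergman_kernel_hartogs_domain\<close>)

\<open>B (T (u, v), T (a, b)) = 1 / (k\<^sup>2 \<pi>\<^sup>2 (v cnj b) ^ k) * (\<Sum>\<omega>. 1 / ((1 - \<omega> u cnj a)\<^sup>2 (1 - v cnj b / \<omega>)\<^sup>2))\<close>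

with \<open>\<omega>\<close> running through the \<open>k\<close>-th roots of unity. The formula is verified through the defining
properties of the kernel, which determine it uniquely (\<open>bergman_kernel_eqI\<close>).

Put \<open>x = u cnj a\<close> and \<open>y = v cnj b\<close>; all values of modulus less than \<open>1\<close> with \<open>y \<noteq> 0\<close> occur. For \<open>x = 0\<close> the sum over
\<open>\<omega>\<close> is \<open>k (1 + (k - 1) y ^ k) / (1 - y ^ k)\<^sup>2\<close>, which vanishes when \<open>y ^ k = - 1 / (k - 1)\<close>. If \<open>k \<ge> 3\<close>, this is
possible with \<open>\<bar>y\<bar> < 1\<close>. For \<open>k = 2\<close> that zero lies on the boundary, but \<open>x = \<i> / 3\<close> and \<open>y = \<i> / 2\<close> give one
in the interior: \<open>(1 - x) (1 - y) = 5 (1 - \<i>) / 6\<close> and \<open>(1 + x) (1 + y) = 5 (1 + \<i>) / 6\<close> have opposite squares,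
so the two terms of the sum cancel.

The analytic ingredients are the change of variables \<open>nn_integral_hartogs_cover\<close>, obtained from polar
coordinates, and the reproducing formulas \<open>disc_bergman_reproducing\<close>,
\<open>punctured_disc_bergman_reproducing\<close> and \<open>punctured_bidisc_bergman_reproducing\<close>.
\<close>

section \<open>Lebesgue measure on the complex plane in exponential polar coordinates\<close>

lemma continuous_on_vector2:
  fixes f g :: "'a::topological_space \<Rightarrow> complex"
  assumes "continuous_on A f" "continuous_on A g"
  shows "continuous_on A (\<lambda>x. vector [f x, g x] :: complex ^ 2)"
proof -
  have eq: "(\<lambda>x. vector [f x, g x] :: complex ^ 2) = (\<lambda>x. \<chi> i. if i = 1 then f x else g x)"
    by (auto simp: vec_eq_iff forall_2)
  have "continuous_on A (\<lambda>x. \<chi> i::2. if i = 1 then f x else g x)"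
  proof (rule continuous_on_vec_lambda)
    show "continuous_on A (\<lambda>x. if i = 1 then f x else g x)" for i :: 2
      using assms by (cases "i = 1") simp_all
  qed
  then show ?thesis
    by (rule ssubst[OF eq, where P = "continuous_on A"])
qed

lemma measurable_vector2 [measurable]:
  "(\<lambda>x. vector [fst x, snd x] :: complex ^ 2) \<in> borel_measurable borel"
  by (intro borel_measurable_continuous_onI continuous_on_vector2 continuous_intros)

lemma measurable_complex_exp [measurable]: "(exp :: complex \<Rightarrow> complex) \<in> borel_measurable borel"
  by (intro borel_measurable_continuous_onI continuous_intros)

lemma measurable_Complex_pair [measurable]:
  "(\<lambda>x. Complex (fst x) (snd x)) \<in> borel_measurable borel"
  by (intro borel_measurable_continuous_onI) (auto simp: Complex_eq intro!: continuous_intros)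

text \<open>The three identifications that follow hold because each map sends boxes to boxes of the same volume.
They move integrals between \<open>complex ^ 2\<close>, where the theorem lives, the products on which Fubini's theorem is
available, and \<open>real ^ 2\<close>, where the change of variables formula is available.\<close>

lemma lborel_vec2:
  "distr (lborel :: (complex \<times> complex) measure) borel (\<lambda>x. vector [fst x, snd x])
      = (lborel :: (complex^2) measure)"
proof (rule lborel_eqI[symmetric])
  fix l u :: "complex^2" assume le: "\<And>b. b \<in> Basis \<Longrightarrow> l \<bullet> b \<le> u \<bullet> b"
  have B: "(Basis :: (complex^2) set) = {axis 1 1, axis 1 \<i>, axis 2 1, axis 2 \<i>}"
    by (auto simp: Basis_vec_def Basis_complex_def UNIV_2)
  have le': "Re (l$1) \<le> Re (u$1)" "Im (l$1) \<le> Im (u$1)" "Re (l$2) \<le> Re (u$2)" "Im (l$2) \<le> Im (u$2)"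
    using le[of "axis 1 1"] le[of "axis 1 \<i>"] le[of "axis 2 1"] le[of "axis 2 \<i>"] unfolding B by (auto simp: inner_axis)
  have "(\<lambda>x::complex\<times>complex. vector [fst x, snd x]) -` box l u = box (l$1,l$2) (u$1,u$2)"
    by (auto simp: mem_box B inner_axis Basis_prod_def Basis_complex_def)
  moreover have "(\<Prod>b\<in>Basis. (u - l) \<bullet> b)
      = (Re (u$1) - Re (l$1)) * (Im (u$1) - Im (l$1)) * (Re (u$2) - Re (l$2)) * (Im (u$2) - Im (l$2))"
    unfolding B by (simp add: inner_axis axis_eq_axis)
  moreover have "(\<Prod>b\<in>Basis. ((u$1,u$2) - (l$1,l$2)) \<bullet> b)
      = (Re (u$1) - Re (l$1)) * (Im (u$1) - Im (l$1)) * (Re (u$2) - Re (l$2)) * (Im (u$2) - Im (l$2))"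
    unfolding Basis_prod_def Basis_complex_def by (simp add: )
  ultimately show "emeasure (distr lborel borel (\<lambda>x. vector [fst x, snd x])) (box l u)
      = (\<Prod>b\<in>Basis. (u - l) \<bullet> b)"
    using le' by (simp add: emeasure_distr emeasure_lborel_box_eq Basis_prod_def Basis_complex_def)
qed simp

lemma measurable_Complex_cart [measurable]: "(\<lambda>v::real^2. Complex (v$1) (v$2)) \<in> borel_measurable borel"
    by (intro borel_measurable_continuous_onI) (auto simp: Complex_eq intro!: continuous_intros)

lemma lborel_real2_complex:
  "distr (lborel :: (real^2) measure) borel (\<lambda>v. Complex (v$1) (v$2)) = lborel"
proof (rule lborel_eqI[symmetric])
  fix l u :: complex assume le: "\<And>b. b \<in> Basis \<Longrightarrow> l \<bullet> b \<le> u \<bullet> b"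
  have B: "(Basis :: (real^2) set) = {axis 1 1, axis 2 1}"
    by (auto simp: Basis_vec_def UNIV_2)
  have "(\<lambda>v::real^2. Complex (v$1) (v$2)) -` box l u = box (vector [Re l, Im l]) (vector [Re u, Im u])"
    by (auto simp: in_box_complex_iff mem_box_cart forall_2)
  then show "emeasure (distr lborel borel (\<lambda>v::real^2. Complex (v$1) (v$2))) (box l u)
      = (\<Prod>b\<in>Basis. (u - l) \<bullet> b)"
    using le[of 1] le[of \<i>] by (auto simp: emeasure_distr emeasure_lborel_box_eq B inner_axis axis_eq_axis Basis_complex_def)
qed simp

lemma lborel_real_pair_complex:
  "distr (lborel :: (real \<times> real) measure) borel (\<lambda>x. Complex (fst x) (snd x)) = lborel"
proof (rule lborel_eqI[symmetric])
  fix l u :: complex assume le: "\<And>b. b \<in> Basis \<Longrightarrow> l \<bullet> b \<le> u \<bullet> b"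
  have "(\<lambda>x. Complex (fst x) (snd x)) -` box l u = box (Re l, Im l) (Re u, Im u)"
    by (auto simp: in_box_complex_iff mem_box Basis_prod_def)
  then show "emeasure (distr lborel borel (\<lambda>x. Complex (fst x) (snd x))) (box l u)
      = (\<Prod>b\<in>Basis. (u - l) \<bullet> b)"
    using le[of 1] le[of \<i>] by (auto simp: emeasure_distr emeasure_lborel_box_eq Basis_complex_def Basis_prod_def)
qed simp

text \<open>The complex exponential in real coordinates. Its Jacobian determinant is the squared modulus
\<open>exp (2 x)\<close> of its derivative, and it is injective on a strip of height \<open>2 \<pi>\<close>.\<close>

lemma real2_exp_polar:
  fixes S :: "(real^2) set"
  defines "E \<equiv> \<lambda>v::real^2. (vector [exp (v$1) * cos (v$2), exp (v$1) * sin (v$2)] :: real^2)"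
  assumes S: "S \<in> sets lebesgue" "S \<subseteq> {v. \<bar>v$2\<bar> < pi}"
  shows "E ` S \<in> lmeasurable \<and> measure lebesgue (E ` S) = m
      \<longleftrightarrow> ((\<lambda>v. exp (2 * v$1)) has_integral m) S"
proof -
  define E' where "E' = (\<lambda>(v::real^2) (h::real^2). vector [exp (v$1) * cos (v$2) * h$1 - exp (v$1) * sin (v$2) * h$2,
      exp (v$1) * sin (v$2) * h$1 + exp (v$1) * cos (v$2) * h$2] :: real^2)"
  have inj: "inj_on E S"
  proof
    fix v w assume vw: "v \<in> S" "w \<in> S" and eq: "E v = E w"
    have "exp (v$1) * cos (v$2) = exp (w$1) * cos (w$2)" "exp (v$1) * sin (v$2) = exp (w$1) * sin (w$2)"
      using arg_cong[OF eq, of "\<lambda>x. x $ 1"] arg_cong[OF eq, of "\<lambda>x. x $ 2"] by (simp_all add: E_def)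
    then have ex: "exp (Complex (v$1) (v$2)) = exp (Complex (w$1) (w$2))"
      by (intro complex_eqI) (simp_all add: Re_exp Im_exp)
    have "\<bar>v$2\<bar> < pi" "\<bar>w$2\<bar> < pi"
      using S(2) vw by auto
    then have "\<bar>Im (Complex (v$1) (v$2)) - Im (Complex (w$1) (w$2))\<bar> < 2 * pi"
      unfolding complex.sel by linarith
    then have "Complex (v$1) (v$2) = Complex (w$1) (w$2)"
      using ex by (rule exp_complex_eqI)
    then show "v = w" by (simp add: vec_eq_iff forall_2)
  qed
  have der: "(E has_derivative E' x) (at x within S)" for x
  proof -
    have nth: "((\<lambda>v::real^2. v$i) has_derivative (\<lambda>h. h$i)) (at x within S)" for i
      by (rule bounded_linear.has_derivative[OF bounded_linear_vec_nth has_derivative_ident])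
    have d1: "((\<lambda>v::real^2. exp (v$1) * cos (v$2)) has_derivative (\<lambda>h. E' x h $ 1)) (at x within S)"
      by (rule has_derivative_eq_rhs, rule has_derivative_mult, rule has_derivative_exp[OF nth], rule has_derivative_cos[OF nth])
        (simp add: E'_def fun_eq_iff algebra_simps)
    have d2: "((\<lambda>v::real^2. exp (v$1) * sin (v$2)) has_derivative (\<lambda>h. E' x h $ 2)) (at x within S)"
      by (rule has_derivative_eq_rhs, rule has_derivative_mult, rule has_derivative_exp[OF nth], rule has_derivative_sin[OF nth])
        (simp add: E'_def fun_eq_iff algebra_simps)
    show "(E has_derivative E' x) (at x within S)"
    proof (rule has_derivative_componentwise_within[THEN iffD2], rule ballI)
      fix i :: "real^2" assume "i \<in> Basis"
      then consider "i = axis 1 1" | "i = axis 2 1" by (auto simp: Basis_vec_def UNIV_2)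
      then show "((\<lambda>x. E x \<bullet> i) has_derivative (\<lambda>h. E' x h \<bullet> i)) (at x within S)"
        using d1 d2 by cases (simp_all add: inner_axis E_def)
    qed
  qed
  have det: "\<bar>det (matrix (E' x))\<bar> = exp (2 * x$1)" for x
  proof -
    have m: "matrix (E' x) $ i $ j = E' x (axis j 1) $ i" for i j
      by (simp add: matrix_def)
    have "det (matrix (E' x)) = exp (x$1) * cos (x$2) * (exp (x$1) * cos (x$2)) + exp (x$1) * sin (x$2) * (exp (x$1) * sin (x$2))"
      unfolding det_2 m by (simp add: E'_def axis_def)
    also have "\<dots> = exp (x$1) * exp (x$1) * ((cos (x$2))\<^sup>2 + (sin (x$2))\<^sup>2)"
      by algebra
    finally have "det (matrix (E' x)) = exp (x$1) * exp (x$1)"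
      by simp
    then show "\<bar>det (matrix (E' x))\<bar> = exp (2 * x$1)"
       by (simp add: exp_double power2_eq_square)
  qed
  show ?thesis
    using has_measure_differentiable_image[OF S(1) der inj, of m] unfolding det .
qed

text \<open>Polar coordinates with radius \<open>exp x\<close> instead of \<open>r\<close>. In this form multiplication by a constant and
the power map become affine in both coordinates. The image of the open strip misses only a part of the real axis,
which is a null set.\<close>

lemma lborel_complex_exp_polar:
  "(lborel :: complex measure) =
    distr (density lborel (\<lambda>z. indicator {z. \<bar>Im z\<bar> < pi} z * ennreal (exp (2 * Re z)))) borel exp"
proof (rule lborel_eqI)
  fix l u :: complex assume le: "\<And>b. b \<in> Basis \<Longrightarrow> l \<bullet> b \<le> u \<bullet> b"
  define Q where "Q = (\<lambda>v::real^2. Complex (v$1) (v$2))"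
  define P where "P = (\<lambda>z. vector [Re z, Im z] :: real^2)"
  define E where "E = (\<lambda>v::real^2. (vector [exp (v$1) * cos (v$2), exp (v$1) * sin (v$2)] :: real^2))"
  have bexp[measurable]: "exp -` box l u \<in> sets borel"
    by (intro borel_open open_vimage continuous_intros open_box)
  define S where "S = {v. Q v \<in> exp -` box l u \<and> \<bar>v$2\<bar> < pi}"
  define p where "p = (\<Prod>b\<in>Basis. (u - l) \<bullet> b)"
  have QP[simp]: "Q (P z) = z" for z by (simp add: Q_def P_def)
  have PQ[simp]: "P (Q z) = z" for z by (simp add: Q_def P_def vec_eq_iff forall_2)
  have QE: "Q (E v) = exp (Q v)" for v
    by (simp add: Q_def E_def complex_eq_iff Re_exp Im_exp)
  have contQ: "continuous_on A Q" for A unfolding Q_def by (auto simp: Complex_eq intro!: continuous_intros)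
  have mQ[measurable]: "Q \<in> borel_measurable borel" unfolding Q_def by simp
  have lQ: "distr lborel borel Q = lborel" unfolding Q_def by (rule lborel_real2_complex)
  have "S = Q -` (exp -` box l u) \<inter> {v. v$2 < pi} \<inter> {v. - pi < v$2}"
    by (auto simp: S_def)
  moreover have "open (Q -` (exp -` box l u))"
    by (intro open_vimage contQ open_box continuous_intros)
  ultimately have openS: "open S"
    by (auto intro!: open_Int open_halfspace_component_lt_cart open_halfspace_component_gt_cart)
  have ES: "E ` S \<subseteq> Q -` box l u" "Q -` box l u - E ` S \<subseteq> {v. v$2 = 0}"
  proof -
    show "E ` S \<subseteq> Q -` box l u" by (auto simp: S_def QE)
    show "Q -` box l u - E ` S \<subseteq> {v. v$2 = 0}"
    proof (clarify, rule ccontr)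
      fix v assume v: "Q v \<in> box l u" "v \<notin> E ` S" "v$2 \<noteq> 0"
      then have nz: "Q v \<noteq> 0" by (auto simp: Q_def complex_eq_iff)
      define w where "w = Ln (Q v)"
      have ew: "exp w = Q v" using nz by (simp add: w_def)
      have "Im w \<noteq> pi"
        using v(3) ew by (auto simp: Q_def complex_eq_iff Im_exp)
      moreover have "- pi < Im w" "Im w \<le> pi" using mpi_less_Im_Ln[OF nz] Im_Ln_le_pi[OF nz] by (auto simp: w_def)
      ultimately have "P w \<in> S" using v ew by (auto simp: S_def) (simp add: P_def)
      moreover have "E (P w) = v" using QE[of "P w"] ew PQ by (metis QP)
      ultimately show False using v by blast
    qed
  qed
  have box: "Q -` box l u = box (P l) (P u)"
    by (auto simp: Q_def P_def in_box_complex_iff mem_box_cart forall_2)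
  have "p \<ge> 0" unfolding p_def using le by (intro prod_nonneg) (auto simp: inner_diff_left)
  have "emeasure lborel (Q -` box l u) = emeasure (distr lborel borel Q) (box l u)"
    by (subst emeasure_distr) auto
  also have "\<dots> = p" unfolding lQ p_def by (simp add: emeasure_lborel_box_eq le)
  finally have "measure lebesgue (box (P l) (P u)) = p"
    unfolding box using \<open>p \<ge> 0\<close> by (simp add: measure_def)
  moreover have neg: "negligible {v::real^2. v$2 = 0}"
    by (rule negligible_standard_hyperplane_cart)
  have "negligible (box (P l) (P u) - E ` S \<union> (E ` S - box (P l) (P u)))"
    by (rule negligible_subset[OF neg]) (use ES box in auto)
  moreover have "box (P l) (P u) \<in> lmeasurable" by simp
  ultimately have "E ` S \<in> lmeasurable \<and> measure lebesgue (E ` S) = p"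
    using measure_negligible_symdiff[of "box (P l) (P u)" "E ` S"] lmeasurable_negligible_symdiff[of "box (P l) (P u)" "E ` S"]
    by auto
  then have "((\<lambda>v. exp (2 * v$1)) has_integral p) S"
    unfolding E_def by (subst real2_exp_polar[symmetric]) (use openS in \<open>auto simp: S_def\<close>)
  then have "(\<integral>\<^sup>+v. ennreal (indicator S v * exp (2 * v$1)) \<partial>lborel) = p"
    by (rule nn_integral_has_integral_lebesgue[rotated]) simp
  then have int: "(\<integral>\<^sup>+v. ennreal (indicator S v * exp (2 * v$1)) \<partial>lborel)
      = (\<Prod>b\<in>Basis. (u - l) \<bullet> b)"
    by (simp add: p_def)
  define d where "d = (\<lambda>z. indicator {z. \<bar>Im z\<bar> < pi} z * ennreal (exp (2 * Re z)))"
  have [measurable]: "d \<in> borel_measurable borel" unfolding d_def by measurable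
  have "emeasure (distr (density lborel d) borel exp) (box l u)
     = (\<integral>\<^sup>+z. d z * indicator (exp -` box l u) z \<partial>lborel)"
    by (simp add: emeasure_distr emeasure_density)
  also have "\<dots> = (\<integral>\<^sup>+z. d z * indicator (exp -` box l u) z \<partial>distr lborel borel Q)"
    by (simp only: lQ)
  also have "\<dots> = (\<integral>\<^sup>+v. d (Q v) * indicator (exp -` box l u) (Q v) \<partial>lborel)"
    by (rule nn_integral_distr) measurable
  also have "\<dots> = (\<integral>\<^sup>+v. ennreal (indicator S v * exp (2 * v$1)) \<partial>lborel)"
  proof (rule nn_integral_cong)
    fix v :: "real^2"
    show "d (Q v) * indicator (exp -` box l u) (Q v) = ennreal (indicator S v * exp (2 * v$1))"
      by (simp add: S_def d_def indicator_def, simp add: Q_def)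
  qed
  finally show "emeasure (distr (density lborel (\<lambda>z. indicator {z. \<bar>Im z\<bar> < pi} z * ennreal (exp (2 * Re z)))) borel exp) (box l u)
      = (\<Prod>b\<in>Basis. (u - l) \<bullet> b)"
    unfolding int d_def .
qed simp

lemma nn_integral_complex_exp_polar:
  fixes f :: "complex \<Rightarrow> ennreal"
  assumes [measurable]: "f \<in> borel_measurable borel"
  shows "(\<integral>\<^sup>+z. f z \<partial>lborel) =
    (\<integral>\<^sup>+x. \<integral>\<^sup>+y. indicator {-pi<..<pi} y * ennreal (exp (2 * x)) * f (exp (Complex x y)) \<partial>lborel \<partial>lborel)"
proof -
  have [measurable]: "(\<lambda>x. Complex (fst x) (snd x)) \<in> borel_measurable (lborel \<Otimes>\<^sub>M lborel)"
    by (simp add: lborel_prod)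
  define g where "g = (\<lambda>z. indicator {z. \<bar>Im z\<bar> < pi} z * ennreal (exp (2 * Re z)) * f (exp z))"
  have [measurable]: "g \<in> borel_measurable borel" unfolding g_def by measurable
  have g: "g (Complex x y) = indicator {-pi<..<pi} y * ennreal (exp (2 * x)) * f (exp (Complex x y))" for x y
    by (auto simp: g_def indicator_def abs_less_iff)
  have "(\<integral>\<^sup>+z. f z \<partial>lborel) = (\<integral>\<^sup>+z. g z \<partial>lborel)"
    by (subst lborel_complex_exp_polar) (simp add: nn_integral_distr nn_integral_density g_def)
  also have "\<dots> = (\<integral>\<^sup>+x. g (Complex (fst x) (snd x)) \<partial>(lborel :: (real\<times>real) measure))"
    by (subst lborel_real_pair_complex[symmetric], subst nn_integral_distr) simp_all
  also have "\<dots> = (\<integral>\<^sup>+x. \<integral>\<^sup>+y. g (Complex x y) \<partial>lborel \<partial>lborel)"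
    using lborel.nn_integral_fst[of "\<lambda>x. g (Complex (fst x) (snd x))" "lborel :: real measure"]
    by (simp add: lborel_prod)
  finally show ?thesis by (simp add: g)
qed

text \<open>The map \<open>y \<mapsto> n y + c\<close> winds the circle \<open>n\<close> times around itself, and the factor \<open>n\<close> gained by the
winding cancels against the derivative.\<close>

lemma nn_integral_periodic_cover:
  fixes p :: "real \<Rightarrow> ennreal" and n :: nat
  assumes p[measurable]: "p \<in> borel_measurable borel" and per: "\<And>x. p (x + 2 * pi) = p x" and n: "n \<ge> 1"
  shows "(\<integral>\<^sup>+y. indicator {-pi<..<pi} y * p (real n * y + c) \<partial>lborel)
      = (\<integral>\<^sup>+y. indicator {-pi<..<pi} y * p y \<partial>lborel)"
proof -
  define I where "I a b = (\<integral>\<^sup>+y. indicator {a..<b} y * p y \<partial>lborel)" for a b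
  \<comment> \<open>Half-open intervals can be cut and translated without overlap.\<close>
  have shift: "I (a + 2 * pi) (b + 2 * pi) = I a b" for a b
  proof -
    have "I (a + 2 * pi) (b + 2 * pi)
        = (\<integral>\<^sup>+y. indicator {a + 2 * pi..<b + 2 * pi} (2 * pi + 1 * y) * p (2 * pi + 1 * y) \<partial>lborel)"
      unfolding I_def by (subst nn_integral_real_affine[where c = 1 and t = "2 * pi"]) simp_all
    also have "\<dots> = I a b"
      unfolding I_def using per by (intro nn_integral_cong) (simp add: indicator_def add.commute)
    finally show ?thesis .
  qed
  have split: "I a c = I a b + I b c" if "a \<le> b" "b \<le> c" for a b c
  proof -
    have "I a c = (\<integral>\<^sup>+y. indicator {a..<b} y * p y + indicator {b..<c} y * p y \<partial>lborel)"
      unfolding I_def using that by (intro nn_integral_cong) (auto simp: indicator_def)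
    then show ?thesis unfolding I_def by (simp add: nn_integral_add)
  qed
  have shift_nat: "I (a + 2 * pi * real m) (b + 2 * pi * real m) = I a b" for a b m
  proof (induction m)
    case (Suc m)
    have "I (a + 2 * pi * real (Suc m)) (b + 2 * pi * real (Suc m)) = I (a + 2 * pi * real m) (b + 2 * pi * real m)"
      using shift[of "a + 2 * pi * real m" "b + 2 * pi * real m"] by (simp add: algebra_simps)
    with Suc show ?case by simp
  qed simp
  have period_aux: "I a (a + 2 * pi) = I 0 (2 * pi)" if "0 \<le> a" "a \<le> 2 * pi" for a
    using split[of a "2 * pi" "a + 2 * pi"] split[of 0 a "2 * pi"] shift[of 0 a] that
    by (simp add: add.commute)
  have period_nonneg: "I a (a + 2 * pi) = I 0 (2 * pi)" if "0 \<le> a" for a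
  proof -
    define m where "m = nat \<lfloor>a / (2 * pi)\<rfloor>"
    have m: "real m \<le> a / (2 * pi)" "a / (2 * pi) < real m + 1"
      using that by (simp_all add: m_def)
    define r where "r = a - 2 * pi * real m"
    have "0 \<le> r" "r \<le> 2 * pi" using m by (simp_all add: r_def field_simps)
    then have "I r (r + 2 * pi) = I 0 (2 * pi)" by (rule period_aux)
    with shift_nat[of r m "r + 2 * pi"] show ?thesis by (simp add: r_def algebra_simps)
  qed
  have period: "I a (a + 2 * pi) = I 0 (2 * pi)" for a
  proof -
    define m where "m = nat \<lceil>- a / (2 * pi)\<rceil>"
    have "- a / (2 * pi) \<le> real m" unfolding m_def by (rule real_nat_ceiling_ge)
    then have "0 \<le> a + 2 * pi * real m" by (simp add: field_simps)
    from period_nonneg[OF this] shift_nat[of a m "a + 2 * pi"] show ?thesis by (simp add: algebra_simps)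
  qed
  have multi: "I a (a + 2 * pi * real m) = of_nat m * I 0 (2 * pi)" for a m
  proof (induction m)
    case 0
    show ?case by (simp add: I_def)
  next
    case (Suc m)
    have "I a (a + 2 * pi * real (Suc m)) = I a (a + 2 * pi * real m) + I (a + 2 * pi * real m) (a + 2 * pi * real m + 2 * pi)"
      using split[of a "a + 2 * pi * real m" "a + 2 * pi * real (Suc m)"] by (simp add: algebra_simps)
    then show ?case
      unfolding Suc.IH period of_nat_Suc distrib_right mult_1 by (metis add.commute)
  qed
  have endpoint: "(\<integral>\<^sup>+y. indicator {-pi<..<pi} y * q y \<partial>lborel)
      = (\<integral>\<^sup>+y. indicator {-pi..<pi} y * q y \<partial>lborel)"
    for q :: "real \<Rightarrow> ennreal"
    using AE_lborel_singleton[of "-pi"] by (intro nn_integral_cong_AE) (auto simp: indicator_def)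
  define a where "a = c - pi * real n"
  have "of_nat n * I 0 (2 * pi) = I a (a + 2 * pi * real n)"
    by (simp add: multi)
  also have "\<dots>
      = ennreal \<bar>real n\<bar> * (\<integral>\<^sup>+y. indicator {a..<a + 2 * pi * real n} (c + real n * y) * p (c + real n * y) \<partial>lborel)"
    unfolding I_def using n by (subst nn_integral_real_affine[where c = "real n" and t = c]) simp_all
  also have "(\<integral>\<^sup>+y. indicator {a..<a + 2 * pi * real n} (c + real n * y) * p (c + real n * y) \<partial>lborel)
      = (\<integral>\<^sup>+y. indicator {-pi..<pi} y * p (real n * y + c) \<partial>lborel)"
  proof (rule nn_integral_cong)
    fix y
    have "c + real n * y \<in> {a..<a + 2 * pi * real n}
        \<longleftrightarrow> real n * (- pi) \<le> real n * y \<and> real n * y < real n * pi"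
      by (auto simp: a_def algebra_simps)
    also have "\<dots> \<longleftrightarrow> y \<in> {-pi..<pi}"
      using n by (subst mult_le_cancel_left_pos, simp, subst mult_less_cancel_left_pos) simp_all
    finally show "indicator {a..<a + 2 * pi * real n} (c + real n * y) * p (c + real n * y)
        = indicator {-pi..<pi} y * p (real n * y + c)"
      by (simp add: indicator_def add.commute)
  qed
  finally have "of_nat n * (\<integral>\<^sup>+y. indicator {-pi..<pi} y * p (real n * y + c) \<partial>lborel)
      = of_nat n * I 0 (2 * pi)"
    by (simp add: ennreal_of_nat_eq_real_of_nat)
  then have "(\<integral>\<^sup>+y. indicator {-pi..<pi} y * p (real n * y + c) \<partial>lborel) = I 0 (2 * pi)"
    using n by (simp add: ennreal_mult_cancel_left ennreal_of_nat_eq_real_of_nat)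
  also have "I 0 (2 * pi) = (\<integral>\<^sup>+y. indicator {-pi..<pi} y * p y \<partial>lborel)"
    using period[of "-pi"] by (simp add: I_def)
  finally show ?thesis unfolding endpoint .
qed

text \<open>The map \<open>z \<mapsto> c z ^ n\<close> has real Jacobian \<open>n\<^sup>2 \<bar>c\<bar>\<^sup>2 \<bar>z\<bar> ^ (2 n - 2)\<close> and is \<open>n\<close>-to-one, which leaves a single
factor \<open>n\<close>. It is needed for \<open>c = 1\<close> and for \<open>n = 1\<close>, which together make up the covering of the Hartogs
domain.\<close>

lemma nn_integral_complex_power_map:
  fixes f :: "complex \<Rightarrow> ennreal" and n :: nat
  assumes f[measurable]: "f \<in> borel_measurable borel" and n: "n \<ge> 1" and c: "c \<noteq> 0"
  shows "(\<integral>\<^sup>+z. ennreal (real n * (cmod c)\<^sup>2 * cmod z ^ (2 * n - 2)) * f (c * z ^ n) \<partial>lborel)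
      = (\<integral>\<^sup>+z. f z \<partial>lborel)"
proof -
  define L where "L = ln (cmod c)"
  define P where "P x = (\<integral>\<^sup>+y. indicator {-pi<..<pi} y * f (exp (Complex x y)) \<partial>lborel)" for x
  have [measurable]: "(\<lambda>x. Complex (fst x) (snd x)) \<in> borel_measurable (lborel \<Otimes>\<^sub>M lborel)"
    by (simp add: lborel_prod)
  have C1[measurable]: "(\<lambda>y. Complex x y) \<in> borel_measurable borel" for x
    by (intro borel_measurable_continuous_onI) (auto simp: Complex_eq intro!: continuous_intros)
  have [measurable]: "(\<lambda>x. \<integral>\<^sup>+y. (indicator {-pi<..<pi} (snd (x,y))
      * f (exp (Complex (fst (x,y)) (snd (x,y))))) \<partial>lborel) \<in> borel_measurable lborel"
    by (rule lborel.borel_measurable_nn_integral_fst) measurable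
  then have [measurable]: "P \<in> borel_measurable borel" unfolding P_def by simp
  \<comment> \<open>In the coordinates \<open>x + \<i> y = ln z\<close> the map is \<open>x \<mapsto> L + n x\<close>, \<open>y \<mapsto> n y + Arg c\<close>.\<close>
  have ec: "exp (Complex L (Arg c)) = c"
    using rcis_cmod_Arg[of c] c by (simp add: L_def exp_eq_polar rcis_def)
  have "(\<integral>\<^sup>+z. ennreal (real n * (cmod c)\<^sup>2 * cmod z ^ (2 * n - 2)) * f (c * z ^ n) \<partial>lborel)
    = (\<integral>\<^sup>+x. \<integral>\<^sup>+y. indicator {-pi<..<pi} y * ennreal (exp (2 * x)) *
         (ennreal (real n * (cmod c)\<^sup>2 * cmod (exp (Complex x y)) ^ (2 * n - 2)) * f (c * exp (Complex x y) ^ n)) \<partial>lborel \<partial>lborel)"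
    by (rule nn_integral_complex_exp_polar) measurable
  also have "\<dots>
      = (\<integral>\<^sup>+x. ennreal (real n) * (ennreal (exp (2 * (L + real n * x))) * P (L + real n * x)) \<partial>lborel)"
  proof (rule nn_integral_cong)
    fix x
    have jac: "exp (2 * x) * (real n * (cmod c)\<^sup>2 * cmod (exp (Complex x y)) ^ (2 * n - 2))
        = real n * exp (2 * (L + real n * x))" for y
    proof -
      have cL: "(cmod c)\<^sup>2 = exp (2 * L)" using c by (simp add: L_def exp_double)
      have "cmod (exp (Complex x y)) ^ (2 * n - 2) = exp (real (2 * n - 2) * x)"
        by (subst exp_of_nat_mult) simp
      then have "exp (2 * x) * (real n * (cmod c)\<^sup>2 * cmod (exp (Complex x y)) ^ (2 * n - 2))
         = real n * (exp (2 * x) * exp (2 * L) * exp (real (2 * n - 2) * x))"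
        unfolding cL by (simp only: ac_simps)
      also have "\<dots> = real n * exp (2 * (L + real n * x))"
        using n by (simp add: exp_add[symmetric] of_nat_diff) (simp add: algebra_simps)
      finally show ?thesis .
    qed
    have arg: "c * exp (Complex x y) ^ n = exp (Complex (L + real n * x) (real n * y + Arg c))" for y
    proof -
      have "Complex (L + real n * x) (real n * y + Arg c) = Complex L (Arg c) + of_nat n * Complex x y"
        by (simp add: complex_eq_iff)
      then show ?thesis by (simp add: exp_add exp_of_nat_mult ec)
    qed
    have "(\<integral>\<^sup>+y. indicator {-pi<..<pi} y * ennreal (exp (2 * x)) *
         (ennreal (real n * (cmod c)\<^sup>2 * cmod (exp (Complex x y)) ^ (2 * n - 2)) * f (c * exp (Complex x y) ^ n)) \<partial>lborel)
      = (\<integral>\<^sup>+y. ennreal (real n * exp (2 * (L + real n * x))) * (indicator {-pi<..<pi} y * f (exp (Complex (L + real n * x) (real n * y + Arg c)))) \<partial>lborel)"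
    proof (rule nn_integral_cong)
      fix y
      have E: "ennreal (exp (2 * x)) * ennreal (real n * (cmod c)\<^sup>2 * cmod (exp (Complex x y)) ^ (2 * n - 2))
          = ennreal (real n * exp (2 * (L + real n * x)))"
        unfolding jac[of y, symmetric] by (rule ennreal_mult[symmetric]) simp_all
      have ac: "i * E * (E' * F) = (E * E') * (i * F)" for i E E' F :: ennreal
        by (simp only: ac_simps)
      show "indicator {-pi<..<pi} y * ennreal (exp (2 * x)) *
         (ennreal (real n * (cmod c)\<^sup>2 * cmod (exp (Complex x y)) ^ (2 * n - 2)) * f (c * exp (Complex x y) ^ n))
        = ennreal (real n * exp (2 * (L + real n * x))) * (indicator {-pi<..<pi} y * f (exp (Complex (L + real n * x) (real n * y + Arg c))))"
        unfolding arg E[symmetric] by (rule ac)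
    qed
    also have "\<dots>
        = ennreal (real n * exp (2 * (L + real n * x))) * (\<integral>\<^sup>+y. indicator {-pi<..<pi} y * f (exp (Complex (L + real n * x) (real n * y + Arg c))) \<partial>lborel)"
      by (rule nn_integral_cmult) measurable
    also have "(\<integral>\<^sup>+y. indicator {-pi<..<pi} y * f (exp (Complex (L + real n * x) (real n * y + Arg c))) \<partial>lborel)
        = P (L + real n * x)"
    proof -
      have "exp (Complex s (t + 2 * pi)) = exp (Complex s t)" for s t
        by (simp add: complex_eq_iff Re_exp Im_exp)
      then show ?thesis
        unfolding P_def by (intro nn_integral_periodic_cover[where p = "\<lambda>t. f (exp (Complex (L
            + real n * x) t))", OF _ _ n]) simp_all
    qed
    finally show "(\<integral>\<^sup>+y. indicator {-pi<..<pi} y * ennreal (exp (2 * x)) *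
         (ennreal (real n * (cmod c)\<^sup>2 * cmod (exp (Complex x y)) ^ (2 * n - 2)) * f (c * exp (Complex x y) ^ n)) \<partial>lborel)
       = ennreal (real n) * (ennreal (exp (2 * (L + real n * x))) * P (L + real n * x))"
      by (simp add: ennreal_mult mult.assoc)
  qed
  also have "\<dots>
      = ennreal (real n) * (\<integral>\<^sup>+x. ennreal (exp (2 * (L + real n * x))) * P (L + real n * x) \<partial>lborel)"
    by (rule nn_integral_cmult) measurable
  also have "\<dots> = (\<integral>\<^sup>+x. ennreal (exp (2 * x)) * P x \<partial>lborel)"
    using n nn_integral_real_affine[of "\<lambda>x. ennreal (exp (2 * x)) * P x" "real n" L] by simp
  also have "\<dots>
      = (\<integral>\<^sup>+x. \<integral>\<^sup>+y. indicator {-pi<..<pi} y * ennreal (exp (2 * x)) * f (exp (Complex x y)) \<partial>lborel \<partial>lborel)"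
  proof (rule nn_integral_cong)
    fix x
    have "ennreal (exp (2 * x)) * P x
        = (\<integral>\<^sup>+y. ennreal (exp (2 * x)) * (indicator {-pi<..<pi} y * f (exp (Complex x y))) \<partial>lborel)"
      unfolding P_def by (rule nn_integral_cmult[symmetric]) measurable
    then show "ennreal (exp (2 * x)) * P x
        = (\<integral>\<^sup>+y. indicator {-pi<..<pi} y * ennreal (exp (2 * x)) * f (exp (Complex x y)) \<partial>lborel)"
      by (simp only: ac_simps)
  qed
  also have "\<dots> = (\<integral>\<^sup>+z. f z \<partial>lborel)"
    by (rule nn_integral_complex_exp_polar[symmetric]) fact
  finally show ?thesis .
qed

section \<open>The covering of the Hartogs domain by the punctured bidisc\<close>

definition punctured_bidisc :: "(complex \<times> complex) set" where
  "punctured_bidisc = ball 0 1 \<times> (ball 0 1 - {0})"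

definition hartogs_cover :: "nat \<Rightarrow> complex \<times> complex \<Rightarrow> complex ^ 2" where
  "hartogs_cover k x = vector [fst x * snd x, snd x ^ k]"

lemma open_punctured_bidisc: "open punctured_bidisc"
  unfolding punctured_bidisc_def by (intro open_Times open_ball open_delete)

text \<open>For a fixed nonzero \<open>b\<close> the covering identifies the slice of the bidisc at \<open>b\<close> with the slice of the
Hartogs domain at \<open>b ^ k\<close>.\<close>

lemma hartogs_cover_in_iff:
  assumes "k \<ge> 1" "b \<noteq> 0"
  shows "vector [b * a, b ^ k] \<in> hartogs_domain k \<longleftrightarrow> (a, b) \<in> punctured_bidisc"
proof -
  have "cmod b ^ k > 0" using assms by simp
  then have "cmod a ^ k * cmod b ^ k < cmod b ^ k \<longleftrightarrow> cmod a ^ k < 1"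
    by simp
  then show ?thesis using assms
    by (auto simp: hartogs_domain_def punctured_bidisc_def norm_mult norm_power power_mult_distrib power_less_one_iff mult.commute)
qed

lemma measurable_vector_pair [measurable]:
  "(\<lambda>(a,b). vector [a, b] :: complex^2) \<in> borel_measurable (lborel \<Otimes>\<^sub>M lborel)"
  using measurable_vector2 by (simp add: lborel_prod split_def)

lemma measurable_hartogs_domain [measurable]: "hartogs_domain k \<in> sets borel"
  by (rule borel_open[OF open_hartogs_domain])

lemma measurable_punctured_bidisc [measurable]: "punctured_bidisc \<in> sets borel"
  by (rule borel_open[OF open_punctured_bidisc])

lemma continuous_on_hartogs_cover: "continuous_on A (hartogs_cover k)"
  unfolding hartogs_cover_def by (intro continuous_on_vector2 continuous_intros)

lemma measurable_hartogs_cover [measurable]: "hartogs_cover k \<in> borel_measurable borel"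
  by (rule borel_measurable_continuous_onI[OF continuous_on_hartogs_cover])

text \<open>Fubini's theorem reduces this to one variable at a time: the second coordinate is substituted by
\<open>b ^ k\<close>, and then, for fixed \<open>b\<close>, the first one by \<open>b a\<close>. The real Jacobian of the covering is
\<open>k\<^sup>2 \<bar>b\<bar> ^ (2 k)\<close>, and one factor \<open>k\<close> is absorbed by the number of sheets.\<close>

lemma nn_integral_hartogs_cover:
  fixes \<phi> :: "complex ^ 2 \<Rightarrow> ennreal"
  assumes [measurable]: "\<phi> \<in> borel_measurable borel" and k: "k \<ge> 1"
  shows "(\<integral>\<^sup>+w. indicator (hartogs_domain k) w * \<phi> w \<partial>lborel) =
    (\<integral>\<^sup>+x. indicator punctured_bidisc x * ennreal (real k * cmod (snd x) ^ (2 * k)) * \<phi> (hartogs_cover k x) \<partial>lborel)"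
proof -
  define \<psi> where "\<psi> w = indicator (hartogs_domain k) w * \<phi> w" for w
  have [measurable]: "\<psi> \<in> borel_measurable borel" unfolding \<psi>_def by measurable
  define \<Psi> where "\<Psi> b = (\<integral>\<^sup>+a. \<psi> (vector [a, b]) \<partial>lborel)" for b
  have m1[measurable]: "(\<lambda>(a,b). \<psi> (vector [a, b])) \<in> borel_measurable (lborel \<Otimes>\<^sub>M lborel)"
    using measurable_compose[OF measurable_vector_pair, of \<psi> borel] by (simp add: split_def)
  have [measurable]: "\<Psi> \<in> borel_measurable borel"
    using lborel.borel_measurable_nn_integral[of "\<lambda>b a. \<psi> (vector [a, b])" lborel] measurable_pair_swap[OF m1]
    unfolding \<Psi>_def by (simp add: split_def)
  have slice[measurable]: "(\<lambda>a. \<psi> (vector [a, b])) \<in> borel_measurable borel" for b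
    using measurable_compose[OF measurable_Pair2'[of b lborel lborel] m1] by simp
  define G where "G
      = (\<lambda>x. indicator punctured_bidisc x * ennreal (real k * cmod (snd x) ^ (2 * k)) * \<phi> (hartogs_cover k x))"
  have [measurable]: "(\<lambda>x::complex\<times>complex. real k * cmod (snd x) ^ (2 * k)) \<in> borel_measurable borel"
    by (intro borel_measurable_continuous_onI continuous_intros)
  have [measurable]: "(\<lambda>x. \<phi> (hartogs_cover k x)) \<in> borel_measurable borel"
    by (rule measurable_compose[OF measurable_hartogs_cover]) fact
  have G[measurable]: "G \<in> borel_measurable borel" unfolding G_def by measurable
  have G2: "case_prod (\<lambda>a b. G (a, b)) \<in> borel_measurable (lborel \<Otimes>\<^sub>M lborel)"
    by (simp add: lborel_prod)
  have "(\<integral>\<^sup>+w. \<psi> w \<partial>lborel)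
      = (\<integral>\<^sup>+w. \<psi> w \<partial>distr lborel borel (\<lambda>x. vector [fst x, snd x]))"
    by (simp only: lborel_vec2)
  also have "\<dots> = (\<integral>\<^sup>+x. \<psi> (vector [fst x, snd x]) \<partial>lborel)"
    by (rule nn_integral_distr) measurable
  also have "\<dots> = (\<integral>\<^sup>+x. \<psi> (vector [fst x, snd x]) \<partial>(lborel \<Otimes>\<^sub>M lborel))"
    by (simp only: lborel_prod)
  also have "\<dots> = (\<integral>\<^sup>+b. \<Psi> b \<partial>lborel)"
    using lborel_pair.nn_integral_snd[OF m1] unfolding \<Psi>_def by (simp add: split_def)
  also have "\<dots>
      = (\<integral>\<^sup>+b. ennreal (real k * (cmod 1)\<^sup>2 * cmod b ^ (2 * k - 2)) * \<Psi> (1 * b ^ k) \<partial>lborel)"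
    by (rule nn_integral_complex_power_map[symmetric]) (use k in simp_all)
  also have "\<dots> = (\<integral>\<^sup>+b. \<integral>\<^sup>+a. G (a, b) \<partial>lborel \<partial>lborel)"
  proof (rule nn_integral_cong_AE, rule AE_mp[OF AE_lborel_singleton[of 0]], rule AE_I2, rule impI)
    fix b :: complex assume b: "b \<noteq> 0"
    have "\<Psi> (b ^ k)
        = (\<integral>\<^sup>+a. ennreal (real 1 * (cmod b)\<^sup>2 * cmod a ^ (2 * 1 - 2)) * \<psi> (vector [b * a ^ 1, b ^ k]) \<partial>lborel)"
      unfolding \<Psi>_def by (rule nn_integral_complex_power_map[symmetric]) (use b in simp_all)
    also have "\<dots> = (\<integral>\<^sup>+a. ennreal ((cmod b)\<^sup>2) * \<psi> (vector [b * a, b ^ k]) \<partial>lborel)"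
      by simp
    finally have "ennreal (real k * (cmod 1)\<^sup>2 * cmod b ^ (2 * k - 2)) * \<Psi> (1 * b ^ k) =
       ennreal (real k * cmod b ^ (2 * k - 2)) * (\<integral>\<^sup>+a. ennreal ((cmod b)\<^sup>2) * \<psi> (vector [b * a, b ^ k]) \<partial>lborel)"
      by simp
    also have "\<dots>
        = (\<integral>\<^sup>+a. ennreal (real k * cmod b ^ (2 * k - 2)) * (ennreal ((cmod b)\<^sup>2) * \<psi> (vector [b * a, b ^ k])) \<partial>lborel)"
    proof (rule nn_integral_cmult[symmetric])
      have "(\<lambda>a. \<psi> (vector [b * a, b ^ k])) \<in> borel_measurable borel"
        by (rule measurable_compose[OF _ slice]) measurable
      then show "(\<lambda>a. ennreal ((cmod b)\<^sup>2) * \<psi> (vector [b * a, b ^ k])) \<in> borel_measurable lborel"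
        by simp
    qed
    also have "\<dots> = (\<integral>\<^sup>+a. G (a, b) \<partial>lborel)"
    proof (rule nn_integral_cong)
      fix a
      have "2 * k = (2 * k - 2) + 2" using k by simp
      then have "cmod b ^ (2 * k) = cmod b ^ (2 * k - 2) * (cmod b)\<^sup>2"
        by (metis power_add)
      then have "ennreal (real k * cmod b ^ (2 * k)) = ennreal (real k * cmod b ^ (2 * k - 2)) * ennreal ((cmod b)\<^sup>2)"
        by (simp add: ennreal_mult[symmetric] mult.assoc)
      moreover have "\<psi> (vector [b * a, b ^ k]) = indicator punctured_bidisc (a, b) * \<phi> (hartogs_cover k (a, b))"
        unfolding \<psi>_def using hartogs_cover_in_iff[OF k b, of a]
        by (simp add: indicator_def hartogs_cover_def mult.commute)
      ultimately show "ennreal (real k * cmod b ^ (2 * k - 2)) * (ennreal ((cmod b)\<^sup>2) * \<psi> (vector [b * a, b ^ k]))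
          = G (a, b)"
        by (simp add: G_def ac_simps)
    qed
    finally show "ennreal (real k * (cmod 1)\<^sup>2 * cmod b ^ (2 * k - 2)) * \<Psi> (1 * b ^ k)
        = (\<integral>\<^sup>+a. G (a, b) \<partial>lborel)" .
  qed
  also have "\<dots> = (\<integral>\<^sup>+x. G x \<partial>(lborel \<Otimes>\<^sub>M lborel))"
    using lborel_pair.nn_integral_snd[OF G2] by (simp add: split_def)
  also have "\<dots> = (\<integral>\<^sup>+x. G x \<partial>lborel)"
    by (simp only: lborel_prod)
  finally show ?thesis unfolding \<psi>_def G_def .
qed

text \<open>The same change of variables as an identity of measures, from which the statements on integrals of
vector valued functions follow.\<close>

lemma distr_hartogs_cover:
  assumes k: "k \<ge> 1"
  shows "distr (density lborel (\<lambda>x. ennreal (indicator punctured_bidisc x * (real k * cmod (snd x) ^ (2 * k))))) borel (hartogs_cover k)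
    = density lborel (\<lambda>w. ennreal (indicator (hartogs_domain k) w))"
proof (rule measure_eqI)
  fix A assume "A \<in> sets (distr (density lborel (\<lambda>x. ennreal (indicator punctured_bidisc x
      * (real k * cmod (snd x) ^ (2 * k))))) borel (hartogs_cover k))"
  then have A[measurable]: "A \<in> sets borel" by simp
  have [measurable]: "(\<lambda>x::complex\<times>complex. real k * cmod (snd x) ^ (2 * k)) \<in> borel_measurable borel"
    by (intro borel_measurable_continuous_onI continuous_intros)
  have vi: "hartogs_cover k -` A \<in> sets borel"
    using measurable_sets_borel[OF measurable_hartogs_cover A] .
  have "emeasure (density lborel (\<lambda>w. ennreal (indicator (hartogs_domain k) w))) A
      = (\<integral>\<^sup>+w. indicator (hartogs_domain k) w * indicator A w \<partial>lborel)"
    by (subst emeasure_density) (simp_all add: ennreal_indicator)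
  also have "\<dots>
      = (\<integral>\<^sup>+x. indicator punctured_bidisc x * ennreal (real k * cmod (snd x) ^ (2 * k)) * indicator A (hartogs_cover k x) \<partial>lborel)"
    by (rule nn_integral_hartogs_cover[OF _ k]) simp_all
  also have "\<dots>
      = emeasure (distr (density lborel (\<lambda>x. ennreal (indicator punctured_bidisc x * (real k * cmod (snd x) ^ (2 * k))))) borel (hartogs_cover k)) A"
    by (simp add: emeasure_distr emeasure_density vi del: indicator_simps)
      (auto intro!: nn_integral_cong simp: indicator_def)
  finally show "emeasure (distr (density lborel (\<lambda>x. ennreal (indicator punctured_bidisc x * (real k * cmod (snd x) ^ (2 * k))))) borel (hartogs_cover k)) A
     = emeasure (density lborel (\<lambda>w. ennreal (indicator (hartogs_domain k) w))) A" by simp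
qed simp

lemma
  fixes \<Phi> :: "complex ^ 2 \<Rightarrow> 'a::{banach, second_countable_topology}"
  assumes [measurable]: "\<Phi> \<in> borel_measurable borel" and k: "k \<ge> 1"
  shows set_integrable_hartogs_cover: "set_integrable lborel (hartogs_domain k) \<Phi> \<longleftrightarrow>
      set_integrable lborel punctured_bidisc (\<lambda>x. (real k * cmod (snd x) ^ (2 * k)) *\<^sub>R \<Phi> (hartogs_cover k x))"
    and set_integral_hartogs_cover: "(LINT w:hartogs_domain k|lborel. \<Phi> w) =
      (LINT x:punctured_bidisc|lborel. (real k * cmod (snd x) ^ (2 * k)) *\<^sub>R \<Phi> (hartogs_cover k x))"
proof -
  have [measurable]: "(\<lambda>x::complex\<times>complex. real k * cmod (snd x) ^ (2 * k)) \<in> borel_measurable borel"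
    by (intro borel_measurable_continuous_onI continuous_intros)
  let ?d = "\<lambda>x::complex\<times>complex. indicator punctured_bidisc x * (real k * cmod (snd x) ^ (2 * k))"
  have "set_integrable lborel (hartogs_domain k) \<Phi>
      \<longleftrightarrow> integrable (density lborel (\<lambda>w. ennreal (indicator (hartogs_domain k) w))) \<Phi>"
    unfolding set_integrable_def by (rule integrable_density[symmetric]) simp_all
  also have "\<dots>
      \<longleftrightarrow> integrable (density lborel (\<lambda>x. ennreal (?d x))) (\<lambda>x. \<Phi> (hartogs_cover k x))"
    unfolding distr_hartogs_cover[OF k, symmetric] by (rule integrable_distr_eq) simp_all
  also have "\<dots> \<longleftrightarrow> integrable lborel (\<lambda>x. ?d x *\<^sub>R \<Phi> (hartogs_cover k x))"
    by (rule integrable_density) simp_all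
  finally show "set_integrable lborel (hartogs_domain k) \<Phi> \<longleftrightarrow>
      set_integrable lborel punctured_bidisc (\<lambda>x. (real k * cmod (snd x) ^ (2 * k)) *\<^sub>R \<Phi> (hartogs_cover k x))"
    unfolding set_integrable_def by (simp only: scaleR_scaleR)
  have "(LINT w:hartogs_domain k|lborel. \<Phi> w)
      = integral\<^sup>L (density lborel (\<lambda>w. ennreal (indicator (hartogs_domain k) w))) \<Phi>"
    unfolding set_lebesgue_integral_def by (rule integral_density[symmetric]) simp_all
  also have "\<dots> = integral\<^sup>L (density lborel (\<lambda>x. ennreal (?d x))) (\<lambda>x. \<Phi> (hartogs_cover k x))"
    unfolding distr_hartogs_cover[OF k, symmetric] by (rule integral_distr) simp_all
  also have "\<dots> = integral\<^sup>L lborel (\<lambda>x. ?d x *\<^sub>R \<Phi> (hartogs_cover k x))"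
    by (rule integral_density) simp_all
  finally show "(LINT w:hartogs_domain k|lborel. \<Phi> w) =
      (LINT x:punctured_bidisc|lborel. (real k * cmod (snd x) ^ (2 * k)) *\<^sub>R \<Phi> (hartogs_cover k x))"
    unfolding set_lebesgue_integral_def by (simp only: scaleR_scaleR)
qed

section \<open>The Bergman kernel of the unit disc\<close>

lemma
  fixes f :: "complex \<Rightarrow> complex"
  assumes f: "integrable lborel f"
  defines "F \<equiv> \<lambda>(x, y). (indicator {-pi<..<pi} y * exp (2 * x)) *\<^sub>R f (exp (Complex x y))"
  shows integrable_complex_exp_polar: "integrable (lborel \<Otimes>\<^sub>M lborel) F"
    and integral_complex_exp_polar: "integral\<^sup>L lborel f = integral\<^sup>L (lborel \<Otimes>\<^sub>M lborel) F"
proof -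
  define d where "d z = indicator {z. \<bar>Im z\<bar> < pi} z * exp (2 * Re z)" for z :: complex
  have [measurable]: "d \<in> borel_measurable borel" unfolding d_def by measurable
  have [measurable]: "f \<in> borel_measurable borel" using f by (simp add: integrable_iff_bounded)
  define g where "g z = d z *\<^sub>R f (exp z)" for z
  have [measurable]: "g \<in> borel_measurable borel" unfolding g_def by measurable
  have d0: "AE z in lborel. 0 \<le> d z" by (simp add: d_def)
  have D: "lborel = distr (density lborel (\<lambda>z. ennreal (d z))) borel exp"
    by (subst lborel_complex_exp_polar) (simp add: d_def ennreal_mult ennreal_indicator)
  have F: "F x = g (Complex (fst x) (snd x))" for x
    by (cases "\<bar>snd x\<bar> < pi") (auto simp: F_def g_def d_def case_prod_beta' indicator_def)
  have "integrable lborel f \<longleftrightarrow> integrable (distr (density lborel (\<lambda>z. ennreal (d z))) borel exp) f"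
    by (simp only: D[symmetric])
  also have "\<dots> \<longleftrightarrow> integrable (density lborel (\<lambda>z. ennreal (d z))) (\<lambda>z. f (exp z))"
    by (rule integrable_distr_eq) simp_all
  also have "\<dots> \<longleftrightarrow> integrable lborel g"
    unfolding g_def by (rule integrable_density[OF _ _ d0]) simp_all
  also have "\<dots> \<longleftrightarrow> integrable (distr lborel borel (\<lambda>x. Complex (fst x) (snd x))) g"
    by (simp only: lborel_real_pair_complex)
  also have "\<dots> \<longleftrightarrow> integrable (lborel \<Otimes>\<^sub>M lborel) F"
    unfolding F lborel_prod by (rule integrable_distr_eq) simp_all
  finally show "integrable (lborel \<Otimes>\<^sub>M lborel) F" using f by simp
  have "integral\<^sup>L lborel f = integral\<^sup>L (distr (density lborel (\<lambda>z. ennreal (d z))) borel exp) f"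
    by (simp only: D[symmetric])
  also have "\<dots> = integral\<^sup>L (density lborel (\<lambda>z. ennreal (d z))) (\<lambda>z. f (exp z))"
    by (rule integral_distr) simp_all
  also have "\<dots> = integral\<^sup>L lborel g"
    unfolding g_def by (rule integral_density[OF _ _ d0]) simp_all
  also have "\<dots> = integral\<^sup>L (distr lborel borel (\<lambda>x. Complex (fst x) (snd x))) g"
    by (simp only: lborel_real_pair_complex)
  also have "\<dots> = integral\<^sup>L (lborel \<Otimes>\<^sub>M lborel) F"
    unfolding F lborel_prod by (rule integral_distr) simp_all
  finally show "integral\<^sup>L lborel f = integral\<^sup>L (lborel \<Otimes>\<^sub>M lborel) F" .
qed

text \<open>On the circle of radius \<open>r\<close> the conjugate of \<open>\<zeta>\<close> is \<open>r\<^sup>2 / \<zeta>\<close>. Therefore \<open>1 / (1 - u cnj \<zeta>)\<^sup>2\<close> is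
\<open>\<zeta>\<^sup>2 / (\<zeta> - u r\<^sup>2)\<^sup>2\<close>, and Cauchy's formula for the derivative of \<open>\<zeta> h \<zeta>\<close> at \<open>s = u r\<^sup>2\<close> evaluates the integral.\<close>

lemma circle_integral_bergman_kernel:
  fixes h :: "complex \<Rightarrow> complex" and u s :: complex and r :: real
  assumes h: "h holomorphic_on ball 0 1" and r: "0 < r" "r < 1" and u: "cmod u < 1"
  defines "s \<equiv> u * of_real (r\<^sup>2)"
  shows "(LINT y|lborel. indicator {-pi<..<pi} y *\<^sub>R (h (of_real r * cis y) / (1 - u * (of_real r * cis (-y)))\<^sup>2)) =
    2 * pi * (h s + s * deriv h s)"
proof -
  define \<Gamma> where "\<Gamma> y = h (of_real r * cis y) / (1 - u * (of_real r * cis (-y)))\<^sup>2" for y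
  define G where "G t = h (- (of_real r * cis t)) / (1 + u * (of_real r * cis (-t)))\<^sup>2" for t
  define H where "H \<zeta> = \<zeta> * h (- \<zeta>)" for \<zeta>
  define w where "w = - s"
  have G: "\<Gamma> (- pi + 1 * t) = G t" for t
  proof -
    have c: "cis (- pi + t) = - cis t" "cis (- (- pi + t)) = - cis (- t)"
      by (simp_all add: complex_eq_iff cos_diff sin_diff cos_add sin_add)
    show ?thesis unfolding \<Gamma>_def G_def mult_1 c by simp
  qed
  \<comment> \<open>The parametrisation of a circle path starts at angle \<open>0\<close> rather than \<open>-\<pi>\<close>. The shift by \<open>\<pi>\<close> turns \<open>\<zeta>\<close>
into \<open>-\<zeta>\<close>, which is why \<open>H\<close> and \<open>w\<close> carry opposite signs.\<close>
  have "(LINT y|lborel. indicator {-pi<..<pi} y *\<^sub>R \<Gamma> y)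
      = (LINT t|lborel. indicator {-pi<..<pi} (- pi + 1 * t) *\<^sub>R \<Gamma> (- pi + 1 * t))"
    by (subst lborel_integral_real_affine[where c = 1 and t = "- pi"]) simp_all
  also have "\<dots> = (LINT t:{0<..<2*pi}|lborel. G t)"
    unfolding G set_lebesgue_integral_def by (intro Bochner_Integration.integral_cong) (auto simp: indicator_def)
  also have "\<dots> = (LINT t:{0..2*pi}|lborel. G t)"
    unfolding set_lebesgue_integral_def
    by (rule integral_discrete_difference[where X = "{0, 2 * pi}"]) (auto simp: indicator_def)
  finally have 1: "(LINT y|lborel. indicator {-pi<..<pi} y *\<^sub>R \<Gamma> y) = (LINT t:{0..2*pi}|lborel. G t)" .
  have nz: "1 + u * (of_real r * cis (-t)) \<noteq> 0" for t
  proof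
    assume "1 + u * (of_real r * cis (-t)) = 0"
    then have "u * (of_real r * cis (-t)) = - 1" by (simp add: add_eq_0_iff)
    then have "cmod u * r
        = 1" using r by (metis abs_of_pos norm_cis norm_minus_cancel norm_mult norm_of_real norm_one mult.right_neutral)
    moreover have "cmod u * r < 1 * 1" using u r by (intro mult_strict_mono) auto
    ultimately show False by simp
  qed
  have conth: "continuous_on (ball 0 1) h" using h by (rule holomorphic_on_imp_continuous_on)
  have contG: "continuous_on {0..2*pi} G"
    unfolding G_def using nz r
    by (intro continuous_intros continuous_on_compose2[OF conth] ballI)
       (auto simp: norm_mult)
  have "set_integrable lborel {0..2*pi} G"
    by (rule borel_integrable_atLeastAtMost') fact
  then have 2: "(LINT t:{0..2*pi}|lborel. G t) = integral {0..2*pi} G"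
    by (rule set_borel_integral_eq_integral(2))
  have hneg: "(\<lambda>\<zeta>. h (- \<zeta>)) holomorphic_on ball 0 1"
    using holomorphic_on_compose_gen[OF holomorphic_on_minus[OF holomorphic_on_ident] h, of "ball 0 1"]
    by (force simp: o_def)
  then have H: "H holomorphic_on ball 0 1" unfolding H_def by (intro holomorphic_intros)
  have cb: "cball 0 r \<subseteq> ball (0::complex) 1" using r by auto
  have sr: "cmod s < r"
  proof -
    have "cmod u * r < 1 * 1" using u r by (intro mult_strict_mono) auto
    then have "cmod u * r * r < 1 * r" using r by (intro mult_strict_right_mono) auto
    then show ?thesis using r by (simp add: s_def norm_mult power2_eq_square norm_power mult.assoc)
  qed
  have wr: "w \<in> ball 0 r" using sr by (simp add: w_def)
  have cH: "continuous_on (cball 0 r) H"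
    using H cb holomorphic_on_imp_continuous_on continuous_on_subset by blast
  have hH: "H holomorphic_on ball 0 r"
    by (rule holomorphic_on_subset[OF H]) (use r in auto)
  have D1: "(H has_field_derivative (1 / (2 * of_real pi * \<i>)
      * contour_integral(circlepath 0 r) (\<lambda>z. H z / (z-w)^2))) (at w)"
    using Cauchy_derivative_integral_circlepath(2)[OF cH hH wr] .
  have s1: "- w \<in> ball 0 1" using sr r by (simp add: w_def)
  have hw: "(h has_field_derivative deriv h (- w)) (at (- w))"
    using h s1 by (intro holomorphic_derivI[OF h]) auto
  have "((\<lambda>z. h (- z)) has_field_derivative deriv h (- w) * (- 1)) (at w)"
    by (rule DERIV_chain'[where f = uminus and g = h, OF _ hw]) (auto intro!: derivative_eq_intros)
  from DERIV_mult[OF DERIV_ident this]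
  have "(H has_field_derivative h s + s * deriv h s) (at w)"
    unfolding H_def w_def by (simp add: add.commute mult.commute)
  from DERIV_unique[OF D1 this]
  have 3: "contour_integral(circlepath 0 r) (\<lambda>z. H z / (z-w)^2) = 2 * pi * \<i> * (h s + s * deriv h s)"
    by (simp add: field_simps)
  have "contour_integral(circlepath 0 r) (\<lambda>z. H z / (z-w)^2)
      = integral {0..2*pi} (\<lambda>t. H (0 + of_real r * cis t) / (0 + of_real r * cis t - w)\<^sup>2 * of_real r * \<i> * cis t)"
    unfolding circlepath_def by (rule contour_integral_part_circlepath_eq) simp
  also have "\<dots> = integral {0..2*pi} (\<lambda>t. \<i> * G t)"
  proof (rule integral_cong)
    fix t
    define e where "e = of_real r * cis t"
    have e0: "e \<noteq> 0" using r by (simp add: e_def)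
    have "1 + u * (of_real r * cis (-t)) = (e - w) / e"
      using e0 r by (simp add: e_def w_def s_def field_simps power2_eq_square cis_mult)
    then have "G t = h (- e) / ((e - w) / e)\<^sup>2"
      by (simp add: G_def e_def)
    moreover have "e - w \<noteq> 0" using nz[of t] \<open>1 + u * (of_real r * cis (-t)) = (e - w) / e\<close> by auto
    ultimately have "\<i> * G t = (e * h (- e)) / (e - w)\<^sup>2 * \<i> * e"
      using e0 by (simp add: power_divide power2_eq_square)
    then show "H (0 + of_real r * cis t) / (0 + of_real r * cis t - w)\<^sup>2 * of_real r * \<i> * cis t = \<i> * G t"
      by (simp add: H_def e_def)
  qed
  also have "\<dots> = \<i> * integral {0..2*pi} G"
    by (rule integral_mult_right)
  finally have "integral {0..2*pi} G = 2 * pi * (h s + s * deriv h s)"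
    using 3 by (simp add: mult.assoc)
  with 1 2 show ?thesis unfolding \<Gamma>_def by simp
qed

lemma norm_one_minus_mult_cnj_ge:
  assumes "cmod a < 1"
  shows "1 - cmod u \<le> cmod (1 - u * cnj a)"
proof -
  have "cmod u * cmod a \<le> cmod u * 1" using assms by (intro mult_left_mono) auto
  then show ?thesis using norm_triangle_ineq2[of 1 "u * cnj a"] by (simp add: norm_mult)
qed

lemma one_minus_mult_cnj_nonzero:
  assumes "cmod a < 1" "cmod u < 1"
  shows "1 - u * cnj a \<noteq> 0"
  using norm_one_minus_mult_cnj_ge[OF assms(1), of u] assms(2) by auto

lemma norm_bergman_factor_le:
  assumes "cmod a < 1" "cmod u < 1"
  shows "cmod (1 / (1 - u * cnj a)\<^sup>2) \<le> 1 / (1 - cmod u)\<^sup>2"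
proof -
  have "(1 - cmod u)\<^sup>2 \<le> (cmod (1 - u * cnj a))\<^sup>2"
    using norm_one_minus_mult_cnj_ge[OF assms(1)] assms by (intro power_mono) auto
  moreover have "0 < 1 - cmod u" using assms by simp
  ultimately show ?thesis
    by (simp add: norm_divide norm_power frac_le)
qed

text \<open>With \<open>s = u r\<^sup>2\<close> the circle integrals weighted by \<open>r\<close> are \<open>\<pi>\<close> times the derivative of \<open>r\<^sup>2 h (u r\<^sup>2)\<close> with respect to \<open>r\<close>,
so integration over the radius gives the boundary value \<open>h u\<close>. The hypothesis on \<open>h\<close> is integrability because
this is what Fubini's theorem supplies on slices of functions of two variables.\<close>

lemma disc_bergman_reproducing:
  fixes h :: "complex \<Rightarrow> complex"
  assumes h: "h holomorphic_on ball 0 1" and int: "set_integrable lborel (ball 0 1) h" and u: "cmod u < 1"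
  shows "set_integrable lborel (ball 0 1) (\<lambda>a. h a / (1 - u * cnj a)\<^sup>2)"
    and "(LINT a:ball 0 1|lborel. h a / (1 - u * cnj a)\<^sup>2) = pi * h u"
proof -
  define f where "f a = indicator (ball 0 1) a *\<^sub>R (h a / (1 - u * cnj a)\<^sup>2)" for a
  have conth: "continuous_on (ball 0 1) h" using h by (rule holomorphic_on_imp_continuous_on)
  have contk: "continuous_on (ball 0 1) (\<lambda>a. h a / (1 - u * cnj a)\<^sup>2)"
    using one_minus_mult_cnj_nonzero u by (intro continuous_intros conth) auto
  have meas: "f \<in> borel_measurable lborel"
    using borel_measurable_continuous_on_indicator[OF _ contk] by (simp add: f_def[abs_def])
  have fint: "integrable lborel f"
  proof (rule Bochner_Integration.integrable_bound[OF _ meas])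
    show "integrable lborel (\<lambda>a. (1 / (1 - cmod u)\<^sup>2) *\<^sub>R (indicator (ball 0 1) a *\<^sub>R h a))"
      using int unfolding set_integrable_def by (rule integrable_scaleR_right)
    show "AE a in lborel. norm (f a) \<le> norm ((1 / (1 - cmod u)\<^sup>2) *\<^sub>R (indicator (ball 0 1) a *\<^sub>R h a))"
    proof (rule AE_I2)
      fix a :: complex
      show "norm (f a) \<le> norm ((1 / (1 - cmod u)\<^sup>2) *\<^sub>R (indicator (ball 0 1) a *\<^sub>R h a))"
      proof (cases "a \<in> ball 0 1")
        case True
        then have "cmod (h a) * cmod (1 / (1 - u * cnj a)\<^sup>2) \<le> cmod (h a) * (1 / (1 - cmod u)\<^sup>2)"
          using u by (intro mult_left_mono norm_bergman_factor_le) auto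
        then show ?thesis using True by (simp add: f_def norm_divide norm_power)
      qed (simp add: f_def)
    qed
  qed
  then show "set_integrable lborel (ball 0 1) (\<lambda>a. h a / (1 - u * cnj a)\<^sup>2)"
    by (simp add: set_integrable_def f_def[abs_def])
  define F where "F = (\<lambda>(x, y). (indicator {-pi<..<pi} y * exp (2 * x)) *\<^sub>R f (exp (Complex x y)))"
  have Fint: "integrable (lborel \<Otimes>\<^sub>M lborel) F" unfolding F_def by (rule integrable_complex_exp_polar[OF fint])
  define s where "s x = u * of_real (exp (2 * x))" for x :: real
  define R where "R x = of_real (2 * pi * exp (2 * x)) * (h (s x) + s x * deriv h (s x))" for x
  have s1: "s x \<in> ball 0 1" if "x < 0" for x
  proof -
    have "cmod u * exp (2 * x) \<le> cmod u * 1" using that by (intro mult_left_mono) auto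
    then show ?thesis using u by (simp add: s_def norm_mult)
  qed
  have inner: "(LINT y|lborel. F (x, y)) = indicator {..<0} x *\<^sub>R R x" for x
  proof (cases "x < 0")
    case True
    have e: "exp (Complex x y) = of_real (exp x) * cis y" for y by (simp add: exp_eq_polar)
    have b: "of_real (exp x) * cis y \<in> ball 0 1" for y using True by (simp add: norm_mult)
    have "F (x, y)
        = exp (2 * x) *\<^sub>R (indicator {-pi<..<pi} y *\<^sub>R (h (of_real (exp x) * cis y) / (1 - u * (of_real (exp x) * cis (-y)))\<^sup>2))" for y
      using b[of y] by (simp add: F_def f_def e cis_cnj)
    then have "(LINT y|lborel. F (x, y))
        = exp (2 * x) *\<^sub>R (LINT y|lborel. indicator {-pi<..<pi} y *\<^sub>R (h (of_real (exp x) * cis y) / (1 - u * (of_real (exp x) * cis (-y)))\<^sup>2))"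
      by (simp only: integral_scaleR_right)
    then have "(LINT y|lborel. F (x, y))
        = exp (2 * x) *\<^sub>R (2 * pi * (h (u * of_real ((exp x)\<^sup>2)) + u * of_real ((exp x)\<^sup>2) * deriv h (u * of_real ((exp x)\<^sup>2))))"
      using circle_integral_bergman_kernel[OF h _ _ u, of "exp x"] True by simp
    then show ?thesis using True by (simp add: R_def s_def exp_double scaleR_conv_of_real)
  next
    case False
    then have "exp (Complex x y) \<notin> ball 0 1" for y by simp
    then have "F (x, y) = 0" for y by (simp add: F_def f_def)
    then show ?thesis using False by simp
  qed
  have "integral\<^sup>L lborel f = integral\<^sup>L (lborel \<Otimes>\<^sub>M lborel) F"
    unfolding F_def by (rule integral_complex_exp_polar[OF fint])
  also have "\<dots> = (LINT x|lborel. LINT y|lborel. F (x, y))"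
    by (rule lborel_pair.integral_fst'[OF Fint, symmetric])
  also have "\<dots> = (LINT x:{..<0}|lborel. R x)"
    unfolding inner set_lebesgue_integral_def ..
  also have "\<dots> = pi * h u"
  proof -
    have Rint: "set_integrable lborel {..<0} R"
      using lborel_pair.integrable_fst'[OF Fint] unfolding inner set_integrable_def .
    \<comment> \<open>The antiderivative of the radial integrand, tending to \<open>0\<close> at the centre of the disc.\<close>
    define A where "A x = of_real (pi * exp (2 * x)) * h (s x)" for x :: real
    have hd: "(h has_field_derivative deriv h z) (at z)" if "z \<in> ball 0 1" for z
      using that by (intro holomorphic_derivI[OF h]) auto
    have sd: "(s has_vector_derivative 2 * s x) (at x)" for x
      unfolding s_def by (auto intro!: derivative_eq_intros simp: has_real_derivative_iff_has_vector_derivative[symmetric] scaleR_conv_of_real)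
    have Ad: "(A has_vector_derivative R x) (at x)" if "x < 0" for x
    proof -
      have d1: "((\<lambda>x. h (s x)) has_vector_derivative 2 * s x * deriv h (s x)) (at x)"
        using field_vector_diff_chain_at[OF sd hd[OF s1[OF that]]] by (simp add: o_def)
      have d2: "((\<lambda>x. of_real (pi * exp (2 * x)) :: complex) has_vector_derivative of_real (2 * pi * exp (2 * x))) (at x)"
        by (intro has_vector_derivative_of_real) (auto intro!: derivative_eq_intros)
      have "(A has_vector_derivative (of_real (pi * exp (2 * x))
          * (2 * s x * deriv h (s x)) + of_real (2 * pi * exp (2 * x)) * h (s x))) (at x)"
        unfolding A_def by (rule has_vector_derivative_mult[OF d2 d1])
      then show ?thesis by (simp add: R_def algebra_simps)
    qed
    have conts: "isCont s x" for x unfolding s_def by (intro continuous_intros)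
    have contR: "isCont R x" if "x < 0" for x
    proof -
      have "isCont h (s x)" using hd[OF s1[OF that]] by (rule DERIV_isCont)
      moreover have "isCont (deriv h) (s x)"
        using holomorphic_on_imp_continuous_on[OF holomorphic_deriv[OF h open_ball]] s1[OF that]
        by (simp add: continuous_on_eq_continuous_at)
      ultimately show ?thesis unfolding R_def
        by (intro continuous_intros isCont_o2[OF conts]) auto
    qed
    have ein: "einterval (-\<infinity>) (ereal 0) = {..<0::real}"
      by (auto simp: einterval_def zero_ereal_def)
    have lim0: "((A \<circ> real_of_ereal) \<longlongrightarrow> pi * h u) (at_left (ereal 0))"
      unfolding ereal_tendsto_simps
    proof -
      have "isCont h u" using hd u by (auto intro: DERIV_isCont)
      then have "isCont (\<lambda>x. A x) 0" unfolding A_def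
        by (intro continuous_intros isCont_o2[OF conts]) (auto simp: s_def)
      then have "(A \<longlongrightarrow> A 0) (at_left 0)"
        by (simp add: isCont_def filterlim_at_split)
      then show "(A \<longlongrightarrow> pi * h u) (at_left 0)" by (simp add: A_def s_def)
    qed
    have liminf: "((A \<circ> real_of_ereal) \<longlongrightarrow> 0) (at_right (-\<infinity>))"
      unfolding ereal_tendsto_simps
    proof -
      have e: "((\<lambda>x::real. exp (2 * x)) \<longlongrightarrow> 0) at_bot"
        by (rule filterlim_compose[OF exp_at_bot]) (auto intro!: filterlim_tendsto_pos_mult_at_bot[OF tendsto_const] filterlim_ident)
      have "(s \<longlongrightarrow> u * of_real 0) at_bot" unfolding s_def
        by (intro tendsto_intros e)
      moreover have "isCont h 0" using hd[of 0] by (auto intro: DERIV_isCont)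
      ultimately have "((\<lambda>x. h (s x)) \<longlongrightarrow> h 0) at_bot"
        by (intro isCont_tendsto_compose[of 0 h s]) simp_all
      then have "(A \<longlongrightarrow> of_real (pi * 0) * h 0) at_bot" unfolding A_def
        by (intro tendsto_intros e)
      then show "(A \<longlongrightarrow> 0) at_bot" by simp
    qed
    have "(LBINT x=-\<infinity>..ereal 0. R x) = pi * h u - 0"
      using Rint by (intro interval_integral_FTC_integrable[OF _ Ad contR _ liminf lim0]) (simp_all add: ein)
    then show ?thesis
      by (simp add: interval_lebesgue_integral_def ein)
  qed
  finally show "(LINT a:ball 0 1|lborel. h a / (1 - u * cnj a)\<^sup>2) = pi * h u"
    unfolding set_lebesgue_integral_def f_def .
qed

section \<open>Removable singularities and the punctured disc\<close>

lemma set_integral_nonneg_mono_set: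
  fixes f :: "'a \<Rightarrow> real"
  assumes "set_integrable M B f" "A \<in> sets M" "A \<subseteq> B" "\<And>x. 0 \<le> f x"
  shows "(LINT x:A|M. f x) \<le> (LINT x:B|M. f x)"
  unfolding set_lebesgue_integral_def
  using set_integrable_subset[OF assms(1-3)] assms
  by (intro integral_mono) (auto simp: set_integrable_def indicator_def)

text \<open>The mean value property is the reproducing formula of the disc at its centre. The parameter \<open>\<eta>\<close> comes
from \<open>2 t \<le> q + t\<^sup>2 / q\<close>, which replaces the Cauchy-Schwarz inequality. If the integral is at most \<open>\<eta>\<^sup>2\<close>, the
bound is \<open>\<eta>\<close>.\<close>

lemma mean_value_disc_bound:
  assumes f: "f holomorphic_on ball v R" and \<rho>: "0 < \<rho>" "\<rho> < R" and \<eta>: "\<eta> > 0"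
    and int: "set_integrable lborel (ball v \<rho>) (\<lambda>z. (cmod (f z))\<^sup>2)"
  shows "\<rho> * cmod (f v) \<le> (\<eta> + (LINT z:ball v \<rho>|lborel. (cmod (f z))\<^sup>2) / \<eta>) / 2"
proof -
  define h where "h a = f (v + of_real \<rho> * a)" for a
  have sub: "(\<lambda>a. v + of_real \<rho> * a) ` ball 0 1 \<subseteq> ball v \<rho>" "(\<lambda>a. v + of_real \<rho> * a) ` cball 0 1 \<subseteq> ball v R"
  proof -
    show "(\<lambda>a. v + of_real \<rho>
        * a) ` ball 0 1 \<subseteq> ball v \<rho>" using \<rho> by (auto simp: dist_norm norm_mult)
    have "\<rho> * cmod a < R" if "cmod a \<le> 1" for a
    proof -
      have "\<rho> * cmod a \<le> \<rho> * 1" using that \<rho> by (intro mult_left_mono) auto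
      then show ?thesis using \<rho> by linarith
    qed
    then show "(\<lambda>a. v + of_real \<rho>
        * a) ` cball 0 1 \<subseteq> ball v R" using \<rho> by (auto simp: dist_norm norm_mult)
  qed
  have contf: "continuous_on (ball v R) f" using f by (rule holomorphic_on_imp_continuous_on)
  have lin: "(\<lambda>a. v + of_real \<rho> * a) holomorphic_on ball 0 1"
    by (intro holomorphic_intros)
  have f\<rho>: "f holomorphic_on ball v \<rho>"
    by (rule holomorphic_on_subset[OF f]) (use \<rho> in auto)
  have hh: "h holomorphic_on ball 0 1"
    using holomorphic_on_compose_gen[OF lin f\<rho> sub(1)] by (simp add: o_def h_def[abs_def])
  have lin': "continuous_on (cball 0 1) (\<lambda>a. v + of_real \<rho> * a)"
    by (intro continuous_intros)
  have ch: "continuous_on (cball 0 1) h"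
    unfolding h_def by (rule continuous_on_compose2[OF contf lin' sub(2)])
  have "set_integrable lborel (cball 0 1) h"
    unfolding set_integrable_def by (rule borel_integrable_compact[OF compact_cball ch])
  then have hint: "set_integrable lborel (ball 0 1) h"
    by (rule set_integrable_subset) auto
  have "set_integrable lborel (cball 0 1) (\<lambda>a. (cmod (h a))\<^sup>2)"
    unfolding set_integrable_def by (intro borel_integrable_compact[OF compact_cball] continuous_intros ch)
  then have h2int: "set_integrable lborel (ball 0 1) (\<lambda>a. (cmod (h a))\<^sup>2)"
    by (rule set_integrable_subset) auto
  have ball1: "set_integrable lborel (ball (0::complex) 1) (\<lambda>a. 1::real)" "(LINT a:ball (0::complex) 1|lborel. (1::real)) = pi"
    using content_ball[of 1 "0::complex"] emeasure_lborel_ball_finite[of "0::complex" 1]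
    by (simp_all add: set_integrable_def set_lebesgue_integral_def integrable_indicator_iff unit_ball_vol_2)
  have "pi * cmod (f v) = cmod (LINT a:ball 0 1|lborel. h a)"
    using disc_bergman_reproducing(2)[OF hh hint, of 0] by (simp add: h_def norm_mult)
  also have "\<dots> \<le> (LINT a:ball 0 1|lborel. cmod (h a))"
    by (rule set_integral_norm_bound[OF hint])
  also have "\<dots> \<le> (LINT a:ball 0 1|lborel. (\<eta> / \<rho> * 1 + \<rho> / \<eta> * (cmod (h a))\<^sup>2) / 2)"
  proof (rule set_integral_mono)
    show "set_integrable lborel (ball 0 1) (\<lambda>a. cmod (h a))" by (rule set_integrable_norm[OF hint])
    show "set_integrable lborel (ball 0 1) (\<lambda>a. (\<eta> / \<rho> * 1 + \<rho> / \<eta> * (cmod (h a))\<^sup>2) / 2)"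
      by (intro set_integrable_divide set_integral_add set_integrable_mult_right ball1 h2int)
    fix a
    \<comment> \<open>With \<open>q = \<eta> / \<rho>\<close> both terms acquire the factor \<open>1 / \<rho>\<close> once the integral is rescaled to radius \<open>\<rho>\<close>.\<close>
    define q where "q = \<eta> / \<rho>"
    have q: "q > 0" "\<rho> / \<eta> = 1 / q" using \<eta> \<rho> by (simp_all add: q_def)
    have "0 \<le> (q - cmod (h a))\<^sup>2 / q" using q by simp
    also have "\<dots> = q + 1 / q * (cmod (h a))\<^sup>2 - 2 * cmod (h a)"
      using q by (simp add: power2_eq_square field_simps)
    finally show "cmod (h a) \<le> (\<eta> / \<rho> * 1 + \<rho> / \<eta> * (cmod (h a))\<^sup>2) / 2"
      unfolding q_def[symmetric] q(2) by simp
  qed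
  also have "\<dots> = (\<eta> / \<rho> * pi + \<rho> / \<eta> * (LINT a:ball 0 1|lborel. (cmod (h a))\<^sup>2)) / 2"
    by (subst set_integral_divide_zero, subst set_integral_add(2))
       (simp_all only: set_integrable_mult_right ball1 h2int set_integral_mult_right)
  also have "(LINT a:ball 0 1|lborel. (cmod (h a))\<^sup>2)
      = (LINT z:ball v \<rho>|lborel. (cmod (f z))\<^sup>2) / \<rho>\<^sup>2"
  proof -
    have "(LINT z|lborel. indicator (ball v \<rho>) z *\<^sub>R (cmod (f z))\<^sup>2)
        = \<rho>\<^sup>2 * (LINT z|lborel. indicator (ball v \<rho>) (v + \<rho> *\<^sub>R z) *\<^sub>R (cmod (f (v + \<rho> *\<^sub>R z)))\<^sup>2)"
    proof -
      have m[measurable]: "(\<lambda>z. indicator (ball v \<rho>) z *\<^sub>R (cmod (f z))\<^sup>2) \<in> borel_measurable borel"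
        using int by (simp add: set_integrable_def integrable_iff_bounded)
      have d: "lborel
          = density (distr lborel borel (\<lambda>x. v + \<rho> *\<^sub>R x)) (\<lambda>_::complex. ennreal (\<rho>\<^sup>2))"
        using lborel_affine[of \<rho> v] \<rho> by simp
      have "(LINT z|lborel. indicator (ball v \<rho>) z *\<^sub>R (cmod (f z))\<^sup>2)
          = (LINT z|density (distr lborel borel (\<lambda>x. v + \<rho> *\<^sub>R x)) (\<lambda>_. ennreal (\<rho>\<^sup>2)). indicator (ball v \<rho>) z *\<^sub>R (cmod (f z))\<^sup>2)"
        by (simp only: d[symmetric])
      also have "\<dots>
          = (LINT z|distr lborel borel (\<lambda>x. v + \<rho> *\<^sub>R x). \<rho>\<^sup>2 *\<^sub>R (indicator (ball v \<rho>) z *\<^sub>R (cmod (f z))\<^sup>2))"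
        using m by (intro integral_density) simp_all
      also have "\<dots>
          = (LINT z|lborel. \<rho>\<^sup>2 *\<^sub>R (indicator (ball v \<rho>) (v + \<rho> *\<^sub>R z) *\<^sub>R (cmod (f (v + \<rho> *\<^sub>R z)))\<^sup>2))"
        using m by (intro integral_distr) simp_all
      finally show ?thesis by simp
    qed
    moreover have "v + \<rho> *\<^sub>R z \<in> ball v \<rho> \<longleftrightarrow> z \<in> ball 0 1" for z
      using \<rho> by (simp add: dist_norm)
    ultimately show ?thesis
      using \<rho> by (simp add: set_lebesgue_integral_def h_def scaleR_conv_of_real indicator_def)
  qed
  also have "(\<eta> / \<rho> * pi + \<rho> / \<eta> * ((LINT z:ball v \<rho>|lborel. (cmod (f z))\<^sup>2) / \<rho>\<^sup>2)) / 2
     \<le> (\<eta> / \<rho> * pi + \<rho> / \<eta> * ((LINT z:ball v \<rho>|lborel. (cmod (f z))\<^sup>2) / \<rho>\<^sup>2) * pi) / 2"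
  proof -
    have "0 \<le> \<rho> / \<eta> * ((LINT z:ball v \<rho>|lborel. (cmod (f z))\<^sup>2) / \<rho>\<^sup>2)"
      using \<rho> \<eta> by (intro mult_nonneg_nonneg divide_nonneg_nonneg) (auto simp: set_lebesgue_integral_def intro!: Bochner_Integration.integral_nonneg)
    moreover have "1 \<le> pi" using pi_ge_two by linarith
    ultimately have "\<rho> / \<eta> * ((LINT z:ball v \<rho>|lborel. (cmod (f z))\<^sup>2) / \<rho>\<^sup>2) * 1
        \<le> \<rho> / \<eta> * ((LINT z:ball v \<rho>|lborel. (cmod (f z))\<^sup>2) / \<rho>\<^sup>2) * pi"
      by (intro mult_left_mono)
    then show ?thesis unfolding mult_1_right by (intro divide_right_mono add_left_mono) simp_all
  qed
  also have "\<dots> = pi * ((\<eta> + (LINT z:ball v \<rho>|lborel. (cmod (f z))\<^sup>2) / \<eta>) / 2 / \<rho>)"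
    using \<rho> \<eta> by (simp add: field_simps power2_eq_square)
  finally have "cmod (f v) \<le> (\<eta> + (LINT z:ball v \<rho>|lborel. (cmod (f z))\<^sup>2) / \<eta>) / 2 / \<rho>"
    by (rule mult_left_le_imp_le) (rule pi_gt_zero)
  then show ?thesis using \<rho> by (simp add: field_simps)
qed

text \<open>On a set of finite measure this follows from \<open>x \<le> 1 + x\<^sup>2\<close>.\<close>

lemma set_integrable_of_square:
  fixes f :: "'a \<Rightarrow> 'b::{banach, second_countable_topology}"
  assumes "emeasure M A < \<infinity>" "A \<in> sets M"
    and "set_borel_measurable M A f" and int: "set_integrable M A (\<lambda>x. (norm (f x))\<^sup>2)"
  shows "set_integrable M A f"
proof -
  have "set_integrable M A (\<lambda>x. 1 + (norm (f x))\<^sup>2)"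
  proof (rule set_integral_add)
    show "set_integrable M A (\<lambda>x. 1::real)"
      using assms(1,2) by (simp add: set_integrable_def integrable_indicator_iff)
  qed (rule int)
  then show ?thesis
  proof (rule set_integrable_bound)
    have "x \<le> 1 + x\<^sup>2" for x :: real
      using zero_le_power2[of "x - 1/2"] by (simp add: power2_eq_square algebra_simps)
    then show "AE x in M. x \<in> A \<longrightarrow> norm (f x) \<le> norm (1 + (norm (f x))\<^sup>2)"
      by (intro AE_I2) (simp add: abs_of_nonneg)
  qed fact
qed

text \<open>The mean value bound on the disc of radius \<open>\<bar>z\<bar> / 2\<close> around \<open>z\<close> shows that \<open>z h z\<close> tends to \<open>0\<close>, because the
integral of \<open>\<bar>h\<bar>\<^sup>2\<close> over small punctured discs tends to \<open>0\<close>. Riemann's theorem does the rest.\<close>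

lemma square_integrable_removable_singularity:
  assumes h: "h holomorphic_on ball 0 1 - {0}"
    and int: "set_integrable lborel (ball 0 1 - {0}) (\<lambda>z. (cmod (h z))\<^sup>2)"
  shows "\<exists>g. g holomorphic_on ball 0 1 \<and> (\<forall>z\<in>ball 0 1 - {0}. g z = h z)"
proof -
  define M where "M \<delta> = (LINT z:ball 0 \<delta> - {0}|lborel. (cmod (h z))\<^sup>2)" for \<delta> :: real
  have subint: "set_integrable lborel A (\<lambda>z. (cmod (h z))\<^sup>2)" if "A \<subseteq> ball 0 1 - {0}" "A \<in> sets borel" for A
    using int by (rule set_integrable_subset) (use that in auto)
  have cont: "(\<lambda>i. LINT z:ball 0 (1 / real (Suc i)) - {0}|lborel. (cmod (h z))\<^sup>2) \<longlonglongrightarrow> (LINT z:(\<Inter>i. ball 0 (1 / real (Suc i)) - {0})|lborel. (cmod (h z))\<^sup>2)"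
  proof (rule set_integral_cont_down)
    show "decseq (\<lambda>i. ball (0::complex) (1 / real (Suc i)) - {0})"
    proof (intro decseq_SucI Diff_mono subset_ball order_refl)
      show "1 / real (Suc (Suc n)) \<le> 1 / real (Suc n)" for n by (rule divide_left_mono) auto
    qed
    show "set_integrable lborel (ball 0 (1 / real (Suc 0)) - {0}) (\<lambda>z. (cmod (h z))\<^sup>2)"
      using int by simp
  qed auto
  have empty: "(\<Inter>i. ball (0::complex) (1 / real (Suc i)) - {0}) = {}"
  proof (rule equals0I)
    fix z :: complex assume z: "z \<in> (\<Inter>i. ball 0 (1 / real (Suc i)) - {0})"
    then have "z \<noteq> 0" by auto
    then obtain n where "inverse (real (Suc n)) < cmod z"
      using reals_Archimedean[of "cmod z"] by auto
    moreover have "cmod z < 1 / real (Suc n)" using z by (auto dest: INT_D[of _ _ _ n])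
    ultimately show False by (simp add: inverse_eq_divide)
  qed
  have lim: "(\<lambda>i. M (1 / real (Suc i))) \<longlonglongrightarrow> 0"
    using cont unfolding empty M_def by (simp add: set_lebesgue_integral_def)
  have bound: "(\<forall>\<^sub>F z in at 0. cmod ((z - 0) * h z) < \<epsilon>)" if \<epsilon>: "\<epsilon> > 0" for \<epsilon>
  proof -
    define \<eta> where "\<eta> = \<epsilon> / 3"
    have \<eta>: "\<eta> > 0" using \<epsilon> by (simp add: \<eta>_def)
    have "\<forall>\<^sub>F i in sequentially. M (1 / real (Suc i)) < \<eta>\<^sup>2"
      by (rule order_tendstoD(2)[OF lim]) (use \<eta> in simp)
    then obtain i where i: "M (1 / real (Suc i)) < \<eta>\<^sup>2" by (auto simp: eventually_sequentially)
    define \<delta> where "\<delta> = 1 / real (Suc i)"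
    have \<delta>: "0 < \<delta>" "\<delta> \<le> 1" by (simp_all add: \<delta>_def)
    have "cmod ((z - 0) * h z) < \<epsilon>" if z: "z \<noteq> 0" "cmod z < \<delta> / 2" for z
    proof -
      define \<rho> where "\<rho> = cmod z / 2"
      have inball: "x \<in> ball 0 \<delta> - {0}" if "x \<in> ball z (cmod z)" for x
      proof -
        have "cmod (x - z) < cmod z" using that by (simp add: dist_norm norm_minus_commute)
        moreover have "cmod x \<le> cmod (x - z) + cmod z" by (metis diff_add_cancel norm_triangle_ineq)
        ultimately show ?thesis using z(2) by auto
      qed
      have sub: "ball z \<rho> \<subseteq> ball 0 \<delta> - {0}"
      proof
        fix x assume "x \<in> ball z \<rho>"
        then have "x \<in> ball z (cmod z)"
          using zero_le_dist[of z x] unfolding \<rho>_def mem_ball by linarith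
        then show "x \<in> ball 0 \<delta> - {0}" by (rule inball)
      qed
      have sub1: "ball 0 \<delta> - {0} \<subseteq> ball (0::complex) 1 - {0}" using \<delta> by auto
      have hz: "h holomorphic_on ball z (cmod z)"
        by (rule holomorphic_on_subset[OF h]) (use inball sub1 in blast)
      have "(LINT x:ball z \<rho>|lborel. (cmod (h x))\<^sup>2) \<le> M \<delta>"
        unfolding M_def by (rule set_integral_nonneg_mono_set[OF subint]) (use sub sub1 in auto)
      then have L: "(LINT x:ball z \<rho>|lborel. (cmod (h x))\<^sup>2) \<le> \<eta>\<^sup>2" using i by (simp add: \<delta>_def)
      have "\<rho> * cmod (h z) \<le> (\<eta> + (LINT x:ball z \<rho>|lborel. (cmod (h x))\<^sup>2) / \<eta>) / 2"
        by (rule mean_value_disc_bound[OF hz]) (use z \<eta> sub sub1 in \<open>auto simp: \<rho>_def intro!: subint\<close>)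
      also have "\<dots> \<le> (\<eta> + \<eta>\<^sup>2 / \<eta>) / 2"
        using L \<eta> by (intro divide_right_mono add_left_mono) auto
      also have "\<dots> = \<eta>" using \<eta> by (simp add: power2_eq_square)
      finally have "cmod z * cmod (h z) \<le> 2 * \<eta>" by (simp add: \<rho>_def)
      also have "\<dots> < \<epsilon>" using \<epsilon> by (simp add: \<eta>_def)
      finally show ?thesis by (simp add: norm_mult)
    qed
    then show ?thesis
      unfolding eventually_at using \<delta> by (intro exI[of _ "\<delta> / 2"]) (auto simp: dist_norm)
  qed
  have "((\<lambda>z. (z - 0) * h z) \<longlongrightarrow> 0) (at 0)"
    unfolding tendsto_iff dist_norm using bound by simp
  then show ?thesis
    by (subst holomorphic_on_extend_lim[OF h]) simp_all
qed

lemma punctured_disc_bergman_reproducing: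
  fixes h :: "complex \<Rightarrow> complex"
  assumes h: "h holomorphic_on ball 0 1 - {0}"
    and int: "set_integrable lborel (ball 0 1 - {0}) (\<lambda>z. (cmod (h z))\<^sup>2)"
    and v: "v \<in> ball 0 1 - {0}"
  shows "(LINT b:ball 0 1 - {0}|lborel. h b / (1 - v * cnj b)\<^sup>2) = pi * h v"
proof -
  obtain g where g: "g holomorphic_on ball 0 1" and gh: "\<And>z. z \<in> ball 0 1 - {0} \<Longrightarrow> g z = h z"
    using square_integrable_removable_singularity[OF h int] by blast
  have diff: "indicator (ball 0 1 - {0}) z *\<^sub>R f (h z) z = indicator (ball 0 1) z *\<^sub>R f (g z) z" if "z \<notin> {0}" for z :: complex and f :: "complex \<Rightarrow> complex \<Rightarrow> 'b::real_vector"
    using that gh by (auto simp: indicator_def)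
  have contg: "continuous_on (ball 0 1) g" using g by (rule holomorphic_on_imp_continuous_on)
  have gint: "set_integrable lborel (ball 0 1) g"
  proof (rule set_integrable_of_square[OF emeasure_lborel_ball_finite])
    show "set_borel_measurable lborel (ball 0 1) g"
      using borel_measurable_continuous_on_indicator[OF _ contg] by (simp add: set_borel_measurable_def)
    show "set_integrable lborel (ball 0 1) (\<lambda>z. (cmod (g z))\<^sup>2)"
      using int unfolding set_integrable_def
      by (subst (asm) integrable_discrete_difference[where X = "{0}", OF _ _ _ diff[of _ "\<lambda>x _. (cmod x)\<^sup>2"]]) auto
  qed simp
  have "(LINT b:ball 0 1 - {0}|lborel. h b / (1 - v * cnj b)\<^sup>2) = (LINT b:ball 0 1|lborel. g b / (1 - v * cnj b)\<^sup>2)"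
    unfolding set_lebesgue_integral_def
    by (rule integral_discrete_difference[where X = "{0}", OF _ _ _ diff[of _ "\<lambda>x b. x / (1 - v * cnj b)\<^sup>2"]]) auto
  also have "\<dots> = pi * g v"
    by (rule disc_bergman_reproducing[OF g gint]) (use v in auto)
  finally show ?thesis using gh[OF v] by simp
qed

section \<open>The Bergman kernel of the punctured bidisc\<close>

lemma emeasure_punctured_bidisc_finite: "emeasure lborel punctured_bidisc < \<infinity>"
proof -
  have "emeasure lborel punctured_bidisc \<le> emeasure lborel (ball (0::complex \<times> complex) 2)"
  proof (rule emeasure_mono)
    show "punctured_bidisc \<subseteq> ball (0::complex \<times> complex) 2"
    proof
      fix x :: "complex \<times> complex" assume "x \<in> punctured_bidisc"
      then have "norm (fst x) < 1" "norm (snd x) < 1" by (auto simp: punctured_bidisc_def)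
      then have "norm x < 2"
        using norm_Pair_le[of "fst x" "snd x"] by simp
      then show "x \<in> ball 0 2" by simp
    qed
  qed simp
  then show ?thesis using emeasure_lborel_ball_finite[of "0::complex \<times> complex" 2] by (rule le_less_trans)
qed

text \<open>The kernel is a product, so Fubini's theorem reduces the claim to the formulas in one variable. Almost
every slice in the second variable is square integrable, which is what the punctured disc requires. In the first
variable only the slice through the given \<open>v\<close> matters; it could be exceptional, but it is integrable because it
is, up to the factor \<open>\<pi>\<close>, the inner integral itself in the case \<open>u = 0\<close>.\<close>

lemma punctured_bidisc_bergman_reproducing:
  fixes F :: "complex \<times> complex \<Rightarrow> complex"
  assumes contF: "continuous_on punctured_bidisc F"
    and hol1: "\<And>b. b \<in> ball 0 1 - {0} \<Longrightarrow> (\<lambda>a. F (a, b)) holomorphic_on ball 0 1"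
    and hol2: "\<And>a. a \<in> ball 0 1 \<Longrightarrow> (\<lambda>b. F (a, b)) holomorphic_on ball 0 1 - {0}"
    and int2: "set_integrable lborel punctured_bidisc (\<lambda>x. (cmod (F x))\<^sup>2)"
    and u: "u \<in> ball 0 1" and v: "v \<in> ball 0 1 - {0}"
  defines "K \<equiv> \<lambda>u x. 1 / (1 - u * cnj (fst x))\<^sup>2 * (1 / (1 - v * cnj (snd x))\<^sup>2)"
  shows "set_integrable lborel punctured_bidisc (\<lambda>x. F x * K u x)"
    and "(LINT x:punctured_bidisc|lborel. F x * K u x) = pi\<^sup>2 * F (u, v)"
proof -
  define g where "g u x = indicator punctured_bidisc x *\<^sub>R (F x * K u x)" for u x
  have Fint: "set_integrable lborel punctured_bidisc F"
  proof (rule set_integrable_of_square[OF emeasure_punctured_bidisc_finite _ _ int2])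
    show "set_borel_measurable lborel punctured_bidisc F"
      using borel_measurable_continuous_on_indicator[OF _ contF] by (simp add: set_borel_measurable_def)
  qed simp
  note nz = one_minus_mult_cnj_nonzero
  have mem: "x \<in> punctured_bidisc
      \<longleftrightarrow> cmod (fst x) < 1 \<and> cmod (snd x) < 1 \<and> snd x \<noteq> 0" for x
    by (cases x) (auto simp: punctured_bidisc_def)
  have v1: "cmod v < 1" using v by simp
  have gint: "integrable lborel (g u)" if u: "cmod u < 1" for u
  proof (rule Bochner_Integration.integrable_bound)
    define C where "C = 1 / (1 - cmod u)\<^sup>2 * (1 / (1 - cmod v)\<^sup>2)"
    show "integrable lborel (\<lambda>x. C *\<^sub>R (indicator punctured_bidisc x *\<^sub>R F x))"
      using Fint unfolding set_integrable_def by (rule integrable_scaleR_right)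
    have "continuous_on punctured_bidisc (\<lambda>x. F x * K u x)"
      unfolding K_def using u v1 nz by (intro continuous_intros contF) (auto simp: mem)
    then show "g u \<in> borel_measurable lborel"
      using borel_measurable_continuous_on_indicator[of punctured_bidisc] by (simp add: g_def[abs_def])
    show "AE x in lborel. norm (g u x) \<le> norm (C *\<^sub>R (indicator punctured_bidisc x *\<^sub>R F x))"
    proof (rule AE_I2)
      fix x
      show "norm (g u x) \<le> norm (C *\<^sub>R (indicator punctured_bidisc x *\<^sub>R F x))"
      proof (cases "x \<in> punctured_bidisc")
        case True
        then have "cmod (K u x) \<le> C"
          unfolding K_def C_def norm_mult using u v1
          by (intro mult_mono norm_bergman_factor_le) (auto simp: mem)
        then have "cmod (F x) * cmod (K u x) \<le> cmod (F x) * C"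
          by (rule mult_left_mono) simp
        moreover have "C \<ge> 0" by (simp add: C_def)
        ultimately show ?thesis using True by (simp add: g_def norm_mult mult.commute)
      qed (simp add: g_def)
    qed
  qed
  have gint': "integrable (lborel \<Otimes>\<^sub>M lborel) (g u)" if u: "cmod u < 1" for u
    using gint[OF u] by (simp only: lborel_prod)
  have "integrable (lborel \<Otimes>\<^sub>M lborel) (\<lambda>x. indicator punctured_bidisc x *\<^sub>R (cmod (F x))\<^sup>2)"
    using int2 by (simp only: lborel_prod set_integrable_def)
  from lborel_pair.AE_integrable_fst'[OF this]
  have slice: "AE a in lborel. integrable lborel (\<lambda>b. indicator punctured_bidisc (a, b) *\<^sub>R (cmod (F (a, b)))\<^sup>2)" .
  have inner: "AE a in lborel. (LINT b|lborel. g u (a, b))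
      = indicator (ball 0 1) a *\<^sub>R (pi * (F (a, v) / (1 - u * cnj a)\<^sup>2))" for u
    using slice
  proof (rule AE_mp, intro AE_I2 impI)
    fix a assume sl: "integrable lborel (\<lambda>b. indicator punctured_bidisc (a, b) *\<^sub>R (cmod (F (a, b)))\<^sup>2)"
    show "(LINT b|lborel. g u (a, b)) = indicator (ball 0 1) a *\<^sub>R (pi * (F (a, v) / (1 - u * cnj a)\<^sup>2))"
    proof (cases "a \<in> ball 0 1")
      case True
      then have ind: "(indicator punctured_bidisc (a, b) :: real) = indicator (ball 0 1 - {0}) b" for b
        by (auto simp: punctured_bidisc_def indicator_def)
      have sq: "set_integrable lborel (ball 0 1 - {0}) (\<lambda>b. (cmod (F (a, b)))\<^sup>2)"
        using sl unfolding set_integrable_def ind .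
      have "(LINT b|lborel. g u (a, b))
          = (LINT b|lborel. 1 / (1 - u * cnj a)\<^sup>2 * (indicator (ball 0 1 - {0}) b *\<^sub>R (F (a, b) / (1 - v * cnj b)\<^sup>2)))"
        by (intro Bochner_Integration.integral_cong) (simp_all add: g_def ind K_def)
      also have "\<dots> = 1 / (1 - u * cnj a)\<^sup>2 * (LINT b:ball 0 1 - {0}|lborel. F (a, b) / (1 - v * cnj b)\<^sup>2)"
        unfolding set_lebesgue_integral_def by (rule integral_mult_right_zero)
      also have "\<dots> = 1 / (1 - u * cnj a)\<^sup>2 * (pi * F (a, v))"
        by (subst punctured_disc_bergman_reproducing[OF hol2[OF True] sq v]) simp
      finally show ?thesis using True by (simp add: mult.commute)
    next
      case False
      then have "g u (a, b) = 0" for b by (simp add: g_def punctured_bidisc_def)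
      then show ?thesis using False by simp
    qed
  qed
  have holv: "(\<lambda>a. F (a, v)) holomorphic_on ball 0 1" using hol1 v by blast
  have contv: "continuous_on (ball 0 1) (\<lambda>a. F (a, v))" using holv by (rule holomorphic_on_imp_continuous_on)
  have meas: "(\<lambda>a. indicator (ball 0 1) a *\<^sub>R (pi
      * (F (a, v) / (1 - u * cnj a)\<^sup>2))) \<in> borel_measurable lborel"
    if u: "cmod u < 1" for u
  proof -
    have "continuous_on (ball 0 1) (\<lambda>a. pi * (F (a, v) / (1 - u * cnj a)\<^sup>2))"
      using nz u by (intro continuous_intros contv) auto
    then show ?thesis using borel_measurable_continuous_on_indicator[of "ball (0::complex) 1"] by simp
  qed
  have intinner: "integrable lborel (\<lambda>a. indicator (ball 0 1) a *\<^sub>R (pi * (F (a, v) / (1 - u * cnj a)\<^sup>2)))"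
    if u: "cmod u < 1" for u
    using lborel_pair.integrable_fst'[OF gint'[OF u]] meas[OF u] inner
    by (subst integrable_cong_AE[symmetric]) auto
  \<comment> \<open>For \<open>u = 0\<close> the first kernel factor is \<open>1\<close>.\<close>
  have "set_integrable lborel (ball 0 1) (\<lambda>a. of_real pi * F (a, v))"
    using intinner[of 0] by (simp add: set_integrable_def)
  then have "set_integrable lborel (ball 0 1) (\<lambda>a. (1 / of_real pi) * (of_real pi * F (a, v)))"
    by (rule set_integrable_mult_right)
  then have intv: "set_integrable lborel (ball 0 1) (\<lambda>a. F (a, v))" by simp
  have u1: "cmod u < 1" using u by simp
  show "set_integrable lborel punctured_bidisc (\<lambda>x. F x * K u x)"
    using gint[OF u1] by (simp add: set_integrable_def g_def[abs_def])
  have "(LINT x:punctured_bidisc|lborel. F x * K u x) = integral\<^sup>L (lborel \<Otimes>\<^sub>M lborel) (g u)"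
    by (simp only: lborel_prod set_lebesgue_integral_def g_def[abs_def])
  also have "\<dots> = (LINT a|lborel. LINT b|lborel. g u (a, b))"
    by (rule lborel_pair.integral_fst'[OF gint'[OF u1], symmetric])
  also have "\<dots> = (LINT a|lborel. indicator (ball 0 1) a *\<^sub>R (pi * (F (a, v) / (1 - u * cnj a)\<^sup>2)))"
    using lborel_pair.integrable_fst'[OF gint'[OF u1]] meas[OF u1] inner
    by (intro integral_cong_AE) auto
  also have "\<dots> = (LINT a:ball 0 1|lborel. pi * (F (a, v) / (1 - u * cnj a)\<^sup>2))"
    by (simp only: set_lebesgue_integral_def)
  also have "\<dots> = pi * (LINT a:ball 0 1|lborel. F (a, v) / (1 - u * cnj a)\<^sup>2)"
    by (rule set_integral_mult_right)
  also have "\<dots> = pi * (pi * F (u, v))"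
    by (subst disc_bergman_reproducing(2)[OF holv intv u1]) simp
  finally show "(LINT x:punctured_bidisc|lborel. F x * K u x) = pi\<^sup>2 * F (u, v)"
    by (simp add: power2_eq_square)
qed

section \<open>Calculus of holomorphic functions of several variables\<close>

lemma holomorphic_Cn_continuous_on:
  assumes "holomorphic_Cn f \<Omega>"
  shows "continuous_on \<Omega> f"
  using assms unfolding holomorphic_Cn_def
  by (meson continuous_at_imp_continuous_on has_derivative_continuous)

lemma holomorphic_Cn_const: "holomorphic_Cn (\<lambda>_. c) \<Omega>"
  unfolding holomorphic_Cn_def by (auto intro!: exI[of _ "\<lambda>_. 0"] derivative_eq_intros)

lemma holomorphic_Cn_component: "holomorphic_Cn (\<lambda>z. z $ i) \<Omega>"
  unfolding holomorphic_Cn_def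
  by (auto intro!: exI[of _ "\<lambda>h. h $ i"] bounded_linear.has_derivative[OF bounded_linear_vec_nth has_derivative_ident])

lemma holomorphic_Cn_add:
  assumes "holomorphic_Cn f \<Omega>" "holomorphic_Cn g \<Omega>"
  shows "holomorphic_Cn (\<lambda>z. f z + g z) \<Omega>"
  unfolding holomorphic_Cn_def
proof
  fix z assume z: "z \<in> \<Omega>"
  obtain L M where L: "(f has_derivative L) (at z)" "\<And>c v. L (c *s v) = c * L v"
    and M: "(g has_derivative M) (at z)" "\<And>c v. M (c *s v) = c * M v"
    using assms z unfolding holomorphic_Cn_def by metis
  then show "\<exists>N. ((\<lambda>z. f z + g z) has_derivative N) (at z) \<and> (\<forall>c v. N (c *s v) = c * N v)"
    by (intro exI[of _ "\<lambda>h. L h + M h"]) (auto intro: has_derivative_add simp: distrib_left)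
qed

lemma holomorphic_Cn_mult:
  assumes "holomorphic_Cn f \<Omega>" "holomorphic_Cn g \<Omega>"
  shows "holomorphic_Cn (\<lambda>z. f z * g z) \<Omega>"
  unfolding holomorphic_Cn_def
proof
  fix z assume z: "z \<in> \<Omega>"
  obtain L M where L: "(f has_derivative L) (at z)" "\<And>c v. L (c *s v) = c * L v"
    and M: "(g has_derivative M) (at z)" "\<And>c v. M (c *s v) = c * M v"
    using assms z unfolding holomorphic_Cn_def by metis
  then show "\<exists>N. ((\<lambda>z. f z * g z) has_derivative N) (at z) \<and> (\<forall>c v. N (c *s v) = c * N v)"
    using has_derivative_mult[OF L(1) M(1)]
    by (intro exI[of _ "\<lambda>h. f z * M h + L h * g z"]) (simp add: algebra_simps)
qed

lemma holomorphic_Cn_chain: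
  assumes f: "holomorphic_Cn f \<Omega>" and g: "\<And>z. z \<in> \<Omega> \<Longrightarrow> (g has_field_derivative g' z) (at (f z))"
  shows "holomorphic_Cn (\<lambda>z. g (f z)) \<Omega>"
  unfolding holomorphic_Cn_def
proof
  fix z assume z: "z \<in> \<Omega>"
  obtain L where L: "(f has_derivative L) (at z)" "\<And>c v. L (c *s v) = c * L v"
    using f z unfolding holomorphic_Cn_def by metis
  have "((\<lambda>z. g (f z)) has_derivative (\<lambda>h. g' z * L h)) (at z)"
    using has_derivative_compose[OF L(1) has_field_derivative_imp_has_derivative[OF g[OF z]]] by simp
  then show "\<exists>N. ((\<lambda>z. g (f z)) has_derivative N) (at z) \<and> (\<forall>c v. N (c *s v) = c * N v)"
    by (intro exI[of _ "\<lambda>h. g' z * L h"]) (simp add: L(2))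
qed

lemma holomorphic_Cn_inverse:
  assumes "holomorphic_Cn f \<Omega>" "\<And>z. z \<in> \<Omega> \<Longrightarrow> f z \<noteq> 0"
  shows "holomorphic_Cn (\<lambda>z. 1 / f z) \<Omega>"
  by (rule holomorphic_Cn_chain[OF assms(1), of "\<lambda>x. 1 / x" "\<lambda>z. - (1 / (f z)\<^sup>2)"])
     (use assms(2) in \<open>auto intro!: derivative_eq_intros simp: power2_eq_square\<close>)

lemma holomorphic_Cn_power:
  assumes "holomorphic_Cn f \<Omega>"
  shows "holomorphic_Cn (\<lambda>z. f z ^ n) \<Omega>"
  by (rule holomorphic_Cn_chain[OF assms, of "\<lambda>x. x ^ n" "\<lambda>z. of_nat n * f z ^ (n - 1)"])
     (auto intro!: derivative_eq_intros)

lemma holomorphic_Cn_sum: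
  assumes "\<And>i. i \<in> I \<Longrightarrow> holomorphic_Cn (f i) \<Omega>"
  shows "holomorphic_Cn (\<lambda>z. \<Sum>i\<in>I. f i z) \<Omega>"
  using assms by (induction I rule: infinite_finite_induct) (auto intro: holomorphic_Cn_const holomorphic_Cn_add)

text \<open>The local representative \<open>f'\<close> may depend on \<open>z\<close>, since the kernel of the Hartogs domain is given by
different branches of a root near different points.\<close>

lemma holomorphic_Cn_locally:
  assumes "\<And>z. z \<in> \<Omega>
      \<Longrightarrow> \<exists>f' U. open U \<and> z \<in> U \<and> (\<forall>w\<in>U. f' w = f w) \<and> holomorphic_Cn f' {z}"
  shows "holomorphic_Cn f \<Omega>"
  unfolding holomorphic_Cn_def
proof
  fix z assume "z \<in> \<Omega>"
  then obtain f' U where U: "open U" "z \<in> U" "\<And>w. w \<in> U \<Longrightarrow> f' w = f w" and f': "holomorphic_Cn f' {z}"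
    using assms by metis
  from f' obtain L where "(f' has_derivative L) (at z)" "\<forall>c v. L (c *s v) = c * L v"
    unfolding holomorphic_Cn_def by blast
  then show "\<exists>L. (f has_derivative L) (at z) \<and> (\<forall>c v. L (c *s v) = c * L v)"
    using U by (intro exI[of _ L]) (auto intro: has_derivative_transform_within_open)
qed

section \<open>Uniqueness of the Bergman kernel\<close>

lemma borel_measurable_indicator_holomorphic_Cn:
  assumes "open \<Omega>" "holomorphic_Cn f \<Omega>"
  shows "(\<lambda>w. indicator \<Omega> w *\<^sub>R f w) \<in> borel_measurable borel"
  using borel_measurable_continuous_on_indicator[OF _ holomorphic_Cn_continuous_on[OF assms(2)]] assms(1) by simp

lemma set_integrable_lebesgue_iff_lborel:
  fixes f :: "'a::euclidean_space \<Rightarrow> 'b::{banach, second_countable_topology}"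
  assumes "(\<lambda>w. indicator \<Omega> w *\<^sub>R f w) \<in> borel_measurable borel"
  shows "set_integrable lebesgue \<Omega> f \<longleftrightarrow> set_integrable lborel \<Omega> f"
    and "(LINT w:\<Omega>|lebesgue. f w) = (LINT w:\<Omega>|lborel. f w)"
  unfolding set_integrable_def set_lebesgue_integral_def
  using assms by (simp_all add: integrable_completion integral_completion)

lemma bergman_space_set_integrable_mult:
  assumes \<Omega>: "open \<Omega>" and f: "f \<in> bergman_space \<Omega>" and g: "(\<lambda>w. cnj (g w)) \<in> bergman_space \<Omega>"
  shows "set_integrable lebesgue \<Omega> (\<lambda>w. g w * f w)"
proof -
  have "set_integrable lebesgue \<Omega> (\<lambda>w. (cmod (g w))\<^sup>2 + (cmod (f w))\<^sup>2)"
    using f g by (intro set_integral_add) (auto simp: bergman_space_def)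
  then show ?thesis
  proof (rule set_integrable_bound)
    have mf: "(\<lambda>w. indicator \<Omega> w *\<^sub>R f w) \<in> borel_measurable borel"
      and mg: "(\<lambda>w. indicator \<Omega> w *\<^sub>R cnj (g w)) \<in> borel_measurable borel"
      using f g by (auto simp: bergman_space_def intro!: borel_measurable_indicator_holomorphic_Cn[OF \<Omega>])
    have "(\<lambda>w. cnj (indicator \<Omega> w *\<^sub>R cnj (g w))
        * (indicator \<Omega> w *\<^sub>R f w)) \<in> borel_measurable borel"
      using mf mg by (intro borel_measurable_times measurable_compose[OF mg borel_measurable_continuous_onI]) (auto intro!: continuous_intros)
    moreover have "(\<lambda>w. cnj (indicator \<Omega> w *\<^sub>R cnj (g w)) * (indicator \<Omega> w *\<^sub>R f w))
        = (\<lambda>w. indicator \<Omega> w *\<^sub>R (g w * f w))"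
      by (auto simp: indicator_def)
    ultimately have "(\<lambda>w. indicator \<Omega> w *\<^sub>R (g w * f w)) \<in> borel_measurable borel" by (simp only:)
    then show "set_borel_measurable lebesgue \<Omega> (\<lambda>w. g w * f w)"
      unfolding set_borel_measurable_def by (simp add: measurable_completion)
    have "x * y \<le> x\<^sup>2 + y\<^sup>2" if "x \<ge> 0" "y \<ge> 0" for x y :: real
      using zero_le_power2[of "x - y"] mult_nonneg_nonneg[OF that] by (simp add: power2_eq_square algebra_simps)
    then show "AE w in lebesgue. w \<in> \<Omega> \<longrightarrow> norm (g w * f w)
        \<le> norm ((cmod (g w))\<^sup>2 + (cmod (f w))\<^sup>2)"
      by (intro AE_I2) (simp add: norm_mult abs_of_nonneg)
  qed
qed

lemma bergman_space_diff:
  assumes \<Omega>: "open \<Omega>" and f: "f \<in> bergman_space \<Omega>" and g: "g \<in> bergman_space \<Omega>"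
  shows "(\<lambda>w. f w - g w) \<in> bergman_space \<Omega>"
proof -
  have "holomorphic_Cn (\<lambda>w. f w + (- 1) * g w) \<Omega>"
    using f g by (intro holomorphic_Cn_add holomorphic_Cn_mult holomorphic_Cn_const) (auto simp: bergman_space_def)
  then have hol: "holomorphic_Cn (\<lambda>w. f w - g w) \<Omega>" by simp
  have "set_integrable lebesgue \<Omega> (\<lambda>w. 2 * (cmod (f w))\<^sup>2 + 2 * (cmod (g w))\<^sup>2)"
    using f g by (intro set_integral_add set_integrable_mult_right) (auto simp: bergman_space_def)
  then have "set_integrable lebesgue \<Omega> (\<lambda>w. (cmod (f w - g w))\<^sup>2)"
  proof (rule set_integrable_bound)
    have "(\<lambda>w. (cmod (indicator \<Omega> w *\<^sub>R (f w - g w)))\<^sup>2) \<in> borel_measurable borel"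
      using borel_measurable_indicator_holomorphic_Cn[OF \<Omega> hol] by measurable
    moreover have "(cmod (indicator \<Omega> w *\<^sub>R (f w - g w)))\<^sup>2
        = indicator \<Omega> w *\<^sub>R (cmod (f w - g w))\<^sup>2" for w
      by (simp add: indicator_def)
    ultimately show "set_borel_measurable lebesgue \<Omega> (\<lambda>w. (cmod (f w - g w))\<^sup>2)"
      unfolding set_borel_measurable_def by (simp add: measurable_completion)
    have "(cmod (x - y))\<^sup>2 \<le> 2 * (cmod x)\<^sup>2 + 2 * (cmod y)\<^sup>2" for x y
    proof -
      have "(cmod (x - y))\<^sup>2 \<le> (cmod x + cmod y)\<^sup>2" by (intro power_mono norm_triangle_ineq4) simp
      also have "\<dots> \<le> 2 * (cmod x)\<^sup>2 + 2 * (cmod y)\<^sup>2"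
        using zero_le_power2[of "cmod x - cmod y"] by (simp add: power2_eq_square algebra_simps)
      finally show ?thesis .
    qed
    then show "AE w in lebesgue. w \<in> \<Omega> \<longrightarrow> norm ((cmod (f w - g w))\<^sup>2)
        \<le> norm (2 * (cmod (f w))\<^sup>2 + 2 * (cmod (g w))\<^sup>2)"
      by (intro AE_I2) (simp add: abs_of_nonneg)
  qed
  with hol show ?thesis by (simp add: bergman_space_def)
qed

text \<open>If two functions represent evaluation at \<open>z\<close>, the conjugate \<open>d\<close> of their difference lies in the Bergman
space and is orthogonal to all of it, hence to itself. So \<open>d\<close> vanishes almost everywhere, and everywhere by
continuity.\<close>

lemma bergman_kernel_eqI:
  assumes \<Omega>: "open \<Omega>" and g: "(\<lambda>w. cnj (g w)) \<in> bergman_space \<Omega>"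
    and rep: "\<And>f. f \<in> bergman_space \<Omega> \<Longrightarrow> f z = (LINT w:\<Omega>|lebesgue. g w * f w)"
    and out: "\<And>w. w \<notin> \<Omega> \<Longrightarrow> g w = 0"
  shows "bergman_kernel \<Omega> z = g"
  unfolding bergman_kernel_def
proof (rule the_equality)
  show "(\<lambda>w. cnj (g w)) \<in> bergman_space \<Omega> \<and> (\<forall>f\<in>bergman_space \<Omega>. f z
      = (LINT w:\<Omega>|lebesgue. g w * f w)) \<and> (\<forall>w. w \<notin> \<Omega> \<longrightarrow> g w = 0)"
    using g rep out by blast
next
  fix k assume "(\<lambda>w. cnj (k w)) \<in> bergman_space \<Omega> \<and> (\<forall>f\<in>bergman_space \<Omega>. f z
      = (LINT w:\<Omega>|lebesgue. k w * f w)) \<and> (\<forall>w. w \<notin> \<Omega> \<longrightarrow> k w = 0)"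
  then have k: "(\<lambda>w. cnj (k w)) \<in> bergman_space \<Omega>" and krep: "\<And>f. f \<in> bergman_space \<Omega> \<Longrightarrow> f z = (LINT w:\<Omega>|lebesgue. k w * f w)"
    and kout: "\<And>w. w \<notin> \<Omega> \<Longrightarrow> k w = 0" by blast+
  define d where "d w = cnj (k w) - cnj (g w)" for w
  have d: "d \<in> bergman_space \<Omega>"
    using bergman_space_diff[OF \<Omega> k g] by (simp add: d_def[abs_def])
  have dhol: "holomorphic_Cn d \<Omega>" and d2: "set_integrable lebesgue \<Omega> (\<lambda>w. (cmod (d w))\<^sup>2)"
    using d by (auto simp: bergman_space_def)
  have "(LINT w:\<Omega>|lebesgue. k w * d w - g w * d w) = d z - d z"
    using bergman_space_set_integrable_mult[OF \<Omega> d k] bergman_space_set_integrable_mult[OF \<Omega> d g] krep[OF d] rep[OF d]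
    by (subst set_integral_diff(2)) simp_all
  moreover have "k w * d w - g w * d w = complex_of_real ((cmod (d w))\<^sup>2)" for w
  proof -
    have "k w * d w - g w * d w = d w * cnj (d w)" by (simp add: d_def algebra_simps)
    then show ?thesis unfolding complex_norm_square .
  qed
  ultimately have "(LINT w:\<Omega>|lebesgue. complex_of_real ((cmod (d w))\<^sup>2)) = 0" by simp
  then have "complex_of_real (LINT w:\<Omega>|lebesgue. (cmod (d w))\<^sup>2) = 0"
    by (subst set_integral_complex_of_real[symmetric])
  then have "integral\<^sup>L lebesgue (\<lambda>w. indicator \<Omega> w *\<^sub>R (cmod (d w))\<^sup>2) = 0"
    by (simp add: set_lebesgue_integral_def)
  then have "AE w in lebesgue. indicator \<Omega> w *\<^sub>R (cmod (d w))\<^sup>2 = 0"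
    using d2 by (subst (asm) integral_nonneg_eq_0_iff_AE) (auto simp: set_integrable_def)
  then have ae: "AE w in lebesgue. w \<in> {w \<in> \<Omega>. d w \<noteq> 0} \<longrightarrow> False"
    by (rule AE_mp) (auto simp: indicator_def)
  define N where "N = {w \<in> \<Omega>. d w \<noteq> 0}"
  have "N = \<Omega> \<inter> d -` (- {0})" by (auto simp: N_def)
  then have "open N"
    using continuous_open_preimage[OF holomorphic_Cn_continuous_on[OF dhol] \<Omega> open_Compl[OF closed_singleton], of 0] by simp
  moreover have "negligible N"
    using ae unfolding N_def[symmetric] negligible_iff_null_sets by (simp add: AE_iff_null_sets \<open>open N\<close>)
  ultimately have "N = {}" using open_not_negligible by blast
  then show "k = g"
    using kout out by (intro ext) (metis (mono_tags, lifting) N_def d_def complex_cnj_cancel_iff empty_Collect_eq right_minus_eq)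
qed

section \<open>The Bergman kernel of the Hartogs domain\<close>

definition roots_of_unity :: "nat \<Rightarrow> complex set" where
  "roots_of_unity k = {\<omega>. \<omega> ^ k = 1}"

text \<open>The Bergman kernel of the Hartogs domain, pulled back along the covering in both arguments: the average over
the deck group of the kernel of the bidisc, multiplied by the number \<open>k\<close> of sheets and divided by the Jacobian
factors \<open>k (snd x) ^ k\<close> and \<open>k (cnj (snd y)) ^ k\<close>.\<close>

definition hartogs_cover_kernel :: "nat \<Rightarrow> complex \<times> complex \<Rightarrow> complex \<times> complex \<Rightarrow> complex" where
  "hartogs_cover_kernel k x y =
    (\<Sum>\<omega>\<in>roots_of_unity k. 1 / (1 - \<omega> * fst x * cnj (fst y))\<^sup>2 * (1 / (1 - snd x / \<omega> * cnj (snd y))\<^sup>2))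
    / (of_nat k ^ 2 * of_real pi ^ 2 * (snd x * cnj (snd y)) ^ k)"

lemma finite_roots_of_unity: "k \<ge> 1 \<Longrightarrow> finite (roots_of_unity k)"
  unfolding roots_of_unity_def using finite_roots_unity[of k] by simp

lemma card_roots_of_unity: "k \<ge> 1 \<Longrightarrow> card (roots_of_unity k) = k"
  unfolding roots_of_unity_def using card_roots_unity_eq[of k] by simp

lemma norm_root_of_unity:
  assumes "k \<ge> 1" "\<omega> \<in> roots_of_unity k"
  shows "cmod \<omega> = 1"
  using assms power_eq_1_iff[of \<omega> k] by (auto simp: roots_of_unity_def)

lemma cnj_root_of_unity:
  assumes "k \<ge> 1" "\<omega> \<in> roots_of_unity k"
  shows "cnj \<omega> = 1 / \<omega>"
  using norm_root_of_unity[OF assms] by (metis complex_div_cnj divide_complex_def mult_1 of_real_1 power_one div_by_1 complex_cnj_cnj)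

text \<open>The fibres of the covering are the orbits of the deck group.\<close>

lemma hartogs_cover_eq_iff:
  assumes k: "k \<ge> 1" and "b \<noteq> 0"
  shows "hartogs_cover k (a', b') = hartogs_cover k (a, b)
      \<longleftrightarrow> (\<exists>\<omega>\<in>roots_of_unity k. a' = a / \<omega> \<and> b' = b * \<omega>)"
proof
  assume "hartogs_cover k (a', b') = hartogs_cover k (a, b)"
  then have eq: "a' * b' = a * b" "b' ^ k = b ^ k"
    by (auto simp: hartogs_cover_def vec_eq_iff forall_2)
  have "b' ^ k \<noteq> 0" using eq(2) assms(2) by simp
  then have "b' \<noteq> 0" using k by (auto simp: power_0_left)
  define \<omega> where "\<omega> = b' / b"
  have "\<omega> ^ k = 1" using eq(2) assms by (simp add: \<omega>_def power_divide)
  moreover have "a' = a / \<omega>" "b' = b * \<omega>"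
    using eq(1) \<open>b' \<noteq> 0\<close> assms(2) by (auto simp: \<omega>_def field_simps)
  ultimately show "\<exists>\<omega>\<in>roots_of_unity k. a' = a / \<omega> \<and> b' = b * \<omega>"
    by (auto simp: roots_of_unity_def)
next
  assume "\<exists>\<omega>\<in>roots_of_unity k. a' = a / \<omega> \<and> b' = b * \<omega>"
  then obtain \<omega> where \<omega>: "\<omega> ^ k = 1" "a' = a / \<omega>" "b' = b * \<omega>" by (auto simp: roots_of_unity_def)
  then have "\<omega> \<noteq> 0" using k by (auto simp: power_0_left)
  with \<omega> show "hartogs_cover k (a', b') = hartogs_cover k (a, b)"
    by (simp add: hartogs_cover_def power_mult_distrib)
qed

text \<open>A deck transformation only permutes the terms of the sum, so the pulled back kernel is constant on
fibres.\<close>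

lemma hartogs_cover_kernel_cong:
  assumes k: "k \<ge> 1" and "b \<noteq> 0" and eq: "hartogs_cover k (a', b') = hartogs_cover k (a, b)"
  shows "hartogs_cover_kernel k x (a', b') = hartogs_cover_kernel k x (a, b)"
proof -
  obtain \<eta> where \<eta>: "\<eta> \<in> roots_of_unity k" "a' = a / \<eta>" "b' = b * \<eta>"
    using hartogs_cover_eq_iff[OF k assms(2)] eq by blast
  have \<eta>0: "\<eta> \<noteq> 0" using norm_root_of_unity[OF k \<eta>(1)] by auto
  have c: "cnj \<eta> = 1 / \<eta>" by (rule cnj_root_of_unity[OF k \<eta>(1)])
  have "(\<Sum>\<omega>\<in>roots_of_unity k. 1 / (1 - \<omega> * fst x * cnj a')\<^sup>2 * (1 / (1 - snd x / \<omega> * cnj b')\<^sup>2))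
     = (\<Sum>\<omega>\<in>roots_of_unity k. 1 / (1 - (\<omega> * \<eta>) * fst x * cnj a)\<^sup>2 * (1 / (1 - snd x / (\<omega> * \<eta>) * cnj b)\<^sup>2))"
    by (intro sum.cong refl) (simp add: \<eta> c mult_ac)
  also have "\<dots>
      = (\<Sum>\<omega>\<in>roots_of_unity k. 1 / (1 - \<omega> * fst x * cnj a)\<^sup>2 * (1 / (1 - snd x / \<omega> * cnj b)\<^sup>2))"
  proof (rule sum.reindex_bij_witness[of _ "\<lambda>\<omega>. \<omega> / \<eta>" "\<lambda>\<omega>. \<omega> * \<eta>"])
  qed (use \<eta>(1) \<eta>0 in \<open>auto simp: roots_of_unity_def power_divide power_mult_distrib\<close>)
  finally have "(\<Sum>\<omega>\<in>roots_of_unity k. 1 / (1 - \<omega> * fst x * cnj a')\<^sup>2 * (1 / (1 - snd x / \<omega> * cnj b')\<^sup>2))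
     = (\<Sum>\<omega>\<in>roots_of_unity k. 1 / (1 - \<omega> * fst x * cnj a)\<^sup>2 * (1 / (1 - snd x / \<omega> * cnj b)\<^sup>2))" .
  moreover have "b' ^ k = b ^ k" using eq by (auto simp: hartogs_cover_def vec_eq_iff forall_2)
  then have "cnj b' ^ k = cnj b ^ k" by (metis complex_cnj_power)
  ultimately show ?thesis by (simp add: hartogs_cover_kernel_def power_mult_distrib)
qed

lemma hartogs_cover_in:
  assumes "k \<ge> 1" "x \<in> punctured_bidisc"
  shows "hartogs_cover k x \<in> hartogs_domain k"
proof (cases x)
  case (Pair a b)
  moreover have "b \<noteq> 0" using Pair assms(2) by (simp add: punctured_bidisc_def)
  ultimately show ?thesis
    using assms hartogs_cover_in_iff[of k b a] by (simp add: hartogs_cover_def mult.commute)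
qed

lemma hartogs_cover_surj:
  assumes k: "k \<ge> 1" and w: "w \<in> hartogs_domain k" and \<beta>: "\<beta> ^ k = w $ 2"
  shows "(w $ 1 / \<beta>, \<beta>) \<in> punctured_bidisc" "hartogs_cover k (w $ 1 / \<beta>, \<beta>) = w"
proof -
  have "w $ 2 \<noteq> 0" using w by (auto simp: hartogs_domain_def)
  then have \<beta>0: "\<beta> \<noteq> 0" using \<beta> k by (auto simp: power_0_left)
  then show eq: "hartogs_cover k (w $ 1 / \<beta>, \<beta>) = w"
    using \<beta> by (simp add: hartogs_cover_def vec_eq_iff forall_2)
  then show "(w $ 1 / \<beta>, \<beta>) \<in> punctured_bidisc"
    using w hartogs_cover_in_iff[OF k \<beta>0, of "w $ 1 / \<beta>"] by (simp add: hartogs_cover_def mult.commute)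
qed

text \<open>An arbitrary, in general discontinuous, choice of a preimage under the covering. By
\<open>hartogs_cover_kernel_cong\<close> the choice does not affect the kernel.\<close>

definition hartogs_lift :: "nat \<Rightarrow> complex ^ 2 \<Rightarrow> complex \<times> complex" where
  "hartogs_lift k w = (let \<beta> = (SOME \<beta>. \<beta> ^ k = w $ 2) in (w $ 1 / \<beta>, \<beta>))"

lemma hartogs_lift:
  assumes k: "k \<ge> 1" and w: "w \<in> hartogs_domain k"
  shows "hartogs_lift k w \<in> punctured_bidisc" "hartogs_cover k (hartogs_lift k w) = w"
proof -
  have "w $ 2 \<noteq> 0" using w by (auto simp: hartogs_domain_def)
  then have "\<exists>\<beta>. \<beta> ^ k = w $ 2"
    using k by (intro exI[of _ "exp (Ln (w $ 2) / of_nat k)"]) (simp add: exp_of_nat_mult[symmetric])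
  then have "(SOME \<beta>. \<beta> ^ k = w $ 2) ^ k = w $ 2" by (rule someI_ex)
  from hartogs_cover_surj[OF k w this] show "hartogs_lift k w \<in> punctured_bidisc" "hartogs_cover k (hartogs_lift k w) = w"
    by (simp_all add: hartogs_lift_def Let_def)
qed

definition hartogs_kernel :: "nat \<Rightarrow> complex \<times> complex \<Rightarrow> complex ^ 2 \<Rightarrow> complex" where
  "hartogs_kernel k x w = (if w \<in> hartogs_domain k then hartogs_cover_kernel k x (hartogs_lift k w) else 0)"

lemma hartogs_kernel_cover:
  assumes k: "k \<ge> 1" and y: "y \<in> punctured_bidisc"
  shows "hartogs_kernel k x (hartogs_cover k y) = hartogs_cover_kernel k x y"
proof -
  have w: "hartogs_cover k y \<in> hartogs_domain k" by (rule hartogs_cover_in[OF k y])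
  have "snd y \<noteq> 0" using y by (auto simp: punctured_bidisc_def)
  then show ?thesis
    using hartogs_cover_kernel_cong[OF k _ , of "snd y" "fst (hartogs_lift k (hartogs_cover k y))" "snd (hartogs_lift k (hartogs_cover k y))" "fst y" x] hartogs_lift(2)[OF k w] w
    by (simp add: hartogs_kernel_def)
qed

text \<open>Near every point the \<open>k\<close>-th root of the second coordinate has a holomorphic branch \<open>\<beta>\<close>, and the kernel may be
computed with this branch instead of the chosen preimage.\<close>

lemma holomorphic_Cn_cnj_hartogs_kernel:
  assumes k: "k \<ge> 1" and x: "x \<in> punctured_bidisc"
  shows "holomorphic_Cn (\<lambda>w. cnj (hartogs_kernel k x w)) (hartogs_domain k)"
proof (rule holomorphic_Cn_locally)
  fix z assume z: "z \<in> hartogs_domain k"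
  define b where "b = snd (hartogs_lift k z)"
  have "hartogs_cover k (hartogs_lift k z) = z" "hartogs_lift k z \<in> punctured_bidisc"
    using hartogs_lift[OF k z] by auto
  then have bk: "b ^ k = z $ 2" and b: "b \<noteq> 0"
    by (auto simp: b_def hartogs_cover_def vec_eq_iff forall_2 punctured_bidisc_def)
  define \<beta> where "\<beta> w = b * exp (Ln (w $ 2 / z $ 2) / of_nat k)" for w :: "complex ^ 2"
  define U where "U = {w. 0 < Re (w $ 2 / z $ 2)} \<inter> hartogs_domain k"
  have z2: "z $ 2 \<noteq> 0" using bk b by auto
  have U: "open U" "z \<in> U"
    unfolding U_def using z z2
    by (auto intro!: open_Int open_hartogs_domain open_Collect_less continuous_intros)
  have \<beta>k: "\<beta> w ^ k = w $ 2" if "w \<in> U" for w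
  proof -
    have "w $ 2 / z $ 2 \<noteq> 0" using that by (auto simp: U_def)
    then show ?thesis
      using k z2 by (simp add: \<beta>_def power_mult_distrib bk exp_of_nat_mult[symmetric])
  qed
  have \<beta>0: "\<beta> w \<noteq> 0" for w using b by (simp add: \<beta>_def)
  define f' where "f' w = cnj (hartogs_cover_kernel k x (w $ 1 / \<beta> w, \<beta> w))" for w
  have eq: "f' w = cnj (hartogs_kernel k x w)" if w: "w \<in> U" for w
  proof -
    have wH: "w \<in> hartogs_domain k" using w by (simp add: U_def)
    show ?thesis
      using hartogs_kernel_cover[OF k hartogs_cover_surj(1)[OF k wH \<beta>k[OF w]], of x] hartogs_cover_surj(2)[OF k wH \<beta>k[OF w]]
      by (simp add: f'_def)
  qed
  have h2: "holomorphic_Cn (\<lambda>w. w $ 2 / z $ 2) {z}"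
    using holomorphic_Cn_mult[OF holomorphic_Cn_component holomorphic_Cn_const, of 2 "1 / z $ 2" "{z}"] by simp
  have h\<beta>: "holomorphic_Cn \<beta> {z}"
    unfolding \<beta>_def
    by (rule holomorphic_Cn_chain[OF h2, of "\<lambda>t. b * exp (Ln t / of_nat k)" "\<lambda>w. b * (exp (Ln 1 / of_nat k) * (1 / of_nat k))"])
       (use z2 k in \<open>auto intro!: derivative_eq_intros\<close>)
  have h\<alpha>: "holomorphic_Cn (\<lambda>w. w $ 1 / \<beta> w) {z}"
    using holomorphic_Cn_mult[OF holomorphic_Cn_component holomorphic_Cn_inverse[OF h\<beta>], of 1] \<beta>0 by simp
  have pb: "(z $ 1 / \<beta> z, \<beta> z) \<in> punctured_bidisc"
    by (rule hartogs_cover_surj[OF k z \<beta>k[OF U(2)]])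
  have n: "cmod (z $ 1 / \<beta> z) < 1" "cmod (\<beta> z) < 1" "cmod (fst x) < 1" "cmod (snd x) < 1" "snd x \<noteq> 0"
    using pb x by (auto simp: punctured_bidisc_def)
  have f': "f' = (\<lambda>w. (\<Sum>\<omega>\<in>roots_of_unity k. 1 / (1 + (- cnj (\<omega> * fst x)) * (w $ 1 / \<beta> w))\<^sup>2 * (1 / (1 + (- cnj (snd x / \<omega>)) * \<beta> w)\<^sup>2))
       * (1 / ((of_nat k ^ 2 * of_real pi ^ 2 * cnj (snd x) ^ k) * \<beta> w ^ k)))"
    by (simp add: fun_eq_iff f'_def hartogs_cover_kernel_def power_mult_distrib mult_ac)
  have "holomorphic_Cn f' {z}"
    unfolding f'
  proof (intro holomorphic_Cn_mult holomorphic_Cn_sum holomorphic_Cn_inverse holomorphic_Cn_power holomorphic_Cn_add holomorphic_Cn_const h\<alpha> h\<beta>)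
    fix \<omega> w assume w: "\<omega> \<in> roots_of_unity k" "w \<in> {z}"
    have \<omega>: "cmod \<omega> = 1" by (rule norm_root_of_unity[OF k w(1)])
    have "cnj (1 - (\<omega> * fst x) * cnj (z $ 1 / \<beta> z)) \<noteq> 0"
      using n \<omega> by (subst complex_cnj_zero_iff, intro one_minus_mult_cnj_nonzero) (auto simp: norm_mult)
    then show "(1 + - cnj (\<omega> * fst x) * (w $ 1 / \<beta> w))\<^sup>2 \<noteq> 0" using w(2) by simp
    have "cnj (1 - (snd x / \<omega>) * cnj (\<beta> z)) \<noteq> 0"
      using n \<omega> by (subst complex_cnj_zero_iff, intro one_minus_mult_cnj_nonzero) (auto simp: norm_divide)
    then show "(1 + - cnj (snd x / \<omega>) * \<beta> w)\<^sup>2 \<noteq> 0" using w(2) by simp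
  qed (use k n(5) \<beta>0 in auto)
  then show "\<exists>f' U. open U \<and> z \<in> U
      \<and> (\<forall>w\<in>U. f' w = cnj (hartogs_kernel k x w)) \<and> holomorphic_Cn f' {z}"
    using U eq by blast
qed

text \<open>The terms of the sum are bounded, so near \<open>b = 0\<close> the kernel grows at most like \<open>\<bar>b\<bar> ^ (- k)\<close>. The Jacobian of the
covering compensates this growth.\<close>

lemma norm_hartogs_cover_kernel_le:
  assumes k: "k \<ge> 1" and x: "x \<in> punctured_bidisc"
  obtains C where "\<And>y. y \<in> punctured_bidisc
      \<Longrightarrow> cmod (hartogs_cover_kernel k x y) * cmod (snd y) ^ k \<le> C"
proof
  fix y assume y: "y \<in> punctured_bidisc"
  define S where "S
      = (\<Sum>\<omega>\<in>roots_of_unity k. 1 / (1 - \<omega> * fst x * cnj (fst y))\<^sup>2 * (1 / (1 - snd x / \<omega> * cnj (snd y))\<^sup>2))"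
  have n: "cmod (fst x) < 1" "cmod (snd x) < 1" "snd x \<noteq> 0" "cmod (fst y) < 1" "cmod (snd y) < 1" "snd y \<noteq> 0"
    using x y by (auto simp: punctured_bidisc_def)
  have "cmod S \<le> of_nat (card (roots_of_unity k)) * (1 / (1 - cmod (fst x))\<^sup>2 * (1 / (1 - cmod (snd x))\<^sup>2))"
    unfolding S_def
  proof (rule sum_norm_bound)
    fix \<omega> assume "\<omega> \<in> roots_of_unity k"
    then have \<omega>: "cmod \<omega> = 1" by (rule norm_root_of_unity[OF k])
    have "cmod (1 / (1 - (\<omega> * fst x) * cnj (fst y))\<^sup>2) \<le> 1 / (1 - cmod (fst x))\<^sup>2"
      using norm_bergman_factor_le[of "fst y" "\<omega> * fst x"] n \<omega> by (simp add: norm_mult)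
    moreover have "cmod (1 / (1 - (snd x / \<omega>) * cnj (snd y))\<^sup>2) \<le> 1 / (1 - cmod (snd x))\<^sup>2"
      using norm_bergman_factor_le[of "snd y" "snd x / \<omega>"] n \<omega> by (simp add: norm_divide)
    ultimately show "cmod (1 / (1 - \<omega> * fst x * cnj (fst y))\<^sup>2 * (1 / (1 - snd x / \<omega> * cnj (snd y))\<^sup>2))
        \<le> 1 / (1 - cmod (fst x))\<^sup>2 * (1 / (1 - cmod (snd x))\<^sup>2)"
      unfolding norm_mult by (intro mult_mono) auto
  qed
  then have "cmod S / (real k ^ 2 * pi ^ 2 * cmod (snd x) ^ k)
      \<le> of_nat (card (roots_of_unity k)) * (1 / (1 - cmod (fst x))\<^sup>2 * (1 / (1 - cmod (snd x))\<^sup>2)) / (real k ^ 2 * pi ^ 2 * cmod (snd x) ^ k)"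
    by (intro divide_right_mono) auto
  moreover have "cmod (hartogs_cover_kernel k x y) * cmod (snd y) ^ k = cmod S / (real k ^ 2 * pi ^ 2 * cmod (snd x) ^ k)"
  proof -
    have "hartogs_cover_kernel k x y = S / (of_nat k ^ 2 * of_real pi ^ 2 * (snd x * cnj (snd y)) ^ k)"
      by (simp only: hartogs_cover_kernel_def S_def)
    then show ?thesis
      using n by (simp add: norm_divide norm_mult norm_power power_mult_distrib)
  qed
  ultimately show "cmod (hartogs_cover_kernel k x y) * cmod (snd y) ^ k
      \<le> of_nat (card (roots_of_unity k)) * (1 / (1 - cmod (fst x))\<^sup>2 * (1 / (1 - cmod (snd x))\<^sup>2)) / (real k ^ 2 * pi ^ 2 * cmod (snd x) ^ k)"
    by simp
qed

text \<open>After the change of variables the squared modulus is bounded on a set of finite measure.\<close>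

lemma cnj_hartogs_kernel_in_bergman_space:
  assumes k: "k \<ge> 1" and x: "x \<in> punctured_bidisc"
  shows "(\<lambda>w. cnj (hartogs_kernel k x w)) \<in> bergman_space (hartogs_domain k)"
proof -
  let ?g = "\<lambda>w. cnj (hartogs_kernel k x w)"
  let ?q = "\<lambda>w. indicator (hartogs_domain k) w *\<^sub>R (cmod (?g w))\<^sup>2"
  have hol: "holomorphic_Cn ?g (hartogs_domain k)"
    by (rule holomorphic_Cn_cnj_hartogs_kernel[OF k x])
  have "(\<lambda>w. (cmod (indicator (hartogs_domain k) w *\<^sub>R ?g w))\<^sup>2) \<in> borel_measurable borel"
    using borel_measurable_indicator_holomorphic_Cn[OF open_hartogs_domain hol] by measurable
  moreover have "(\<lambda>w. (cmod (indicator (hartogs_domain k) w *\<^sub>R ?g w))\<^sup>2) = ?q"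
    by (auto simp: indicator_def)
  ultimately have meas: "?q \<in> borel_measurable borel" by (simp only:)
  obtain C where C: "\<And>y. y \<in> punctured_bidisc
      \<Longrightarrow> cmod (hartogs_cover_kernel k x y) * cmod (snd y) ^ k \<le> C"
    using norm_hartogs_cover_kernel_le[OF k x] by blast
  have "set_integrable lborel punctured_bidisc (\<lambda>_. real k * C\<^sup>2)"
    using emeasure_punctured_bidisc_finite by (simp add: set_integrable_def integrable_indicator_iff)
  then have "set_integrable lborel punctured_bidisc (\<lambda>y. (real k
      * cmod (snd y) ^ (2 * k)) *\<^sub>R ?q (hartogs_cover k y))"
  proof (rule set_integrable_bound)
    have m1: "(\<lambda>y. ?q (hartogs_cover k y)) \<in> borel_measurable borel"
      by (rule measurable_compose[OF measurable_hartogs_cover meas])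
    have m2: "(\<lambda>y::complex\<times>complex. real k * cmod (snd y) ^ (2 * k)) \<in> borel_measurable borel"
      by (intro borel_measurable_continuous_onI continuous_intros)
    show "set_borel_measurable lborel punctured_bidisc (\<lambda>y. (real k
        * cmod (snd y) ^ (2 * k)) *\<^sub>R ?q (hartogs_cover k y))"
      unfolding set_borel_measurable_def measurable_lborel2
      by (rule borel_measurable_scaleR[OF borel_measurable_indicator[OF measurable_punctured_bidisc] borel_measurable_scaleR[OF m2 m1]])
    have "norm ((real k * cmod (snd y) ^ (2 * k)) *\<^sub>R ?q (hartogs_cover k y)) \<le> norm (real k * C\<^sup>2)" if y: "y \<in> punctured_bidisc" for y
    proof -
      have "(cmod (hartogs_cover_kernel k x y) * cmod (snd y) ^ k)\<^sup>2 \<le> C\<^sup>2"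
        by (rule power_mono[OF C[OF y]]) simp
      then have "real k * (cmod (hartogs_cover_kernel k x y) * cmod (snd y) ^ k)\<^sup>2 \<le> real k * C\<^sup>2"
        by (rule mult_left_mono) simp
      then show ?thesis
        using hartogs_cover_in[OF k y] by (simp add: hartogs_kernel_cover[OF k y] power_mult_distrib power_mult[symmetric] mult_ac abs_mult)
    qed
    then show "AE y in lborel. y \<in> punctured_bidisc \<longrightarrow> norm ((real k * cmod (snd y) ^ (2 * k)) *\<^sub>R ?q (hartogs_cover k y))
        \<le> norm (real k * C\<^sup>2)"
      by (intro AE_I2 impI)
  qed
  then have "set_integrable lborel (hartogs_domain k) ?q"
    by (subst set_integrable_hartogs_cover[OF meas k])
  also have "?this \<longleftrightarrow> set_integrable lborel (hartogs_domain k) (\<lambda>w. (cmod (?g w))\<^sup>2)"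
    by (intro set_integrable_cong) simp_all
  finally have "set_integrable lebesgue (hartogs_domain k) (\<lambda>w. (cmod (?g w))\<^sup>2)"
    by (subst set_integrable_lebesgue_iff_lborel(1)[OF meas])
  with hol show ?thesis by (simp add: bergman_space_def)
qed

lemma holomorphic_Cn_compose_curve:
  assumes f: "holomorphic_Cn f \<Omega>" and \<gamma>: "\<And>t i. t \<in> S \<Longrightarrow> ((\<lambda>t. \<gamma> t $ i) has_field_derivative \<gamma>' t $ i) (at t)"
    and sub: "\<gamma> ` S \<subseteq> \<Omega>"
  shows "(\<lambda>t. f (\<gamma> t)) holomorphic_on S"
proof -
  have "\<exists>d. ((\<lambda>t. f (\<gamma> t)) has_field_derivative d) (at t)" if t: "t \<in> S" for t
  proof -
    obtain L where L: "(f has_derivative L) (at (\<gamma> t))" "\<And>c v. L (c *s v) = c * L v"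
      using f sub t unfolding holomorphic_Cn_def by (meson image_subset_iff)
    have "(\<gamma> has_derivative (\<lambda>h. h *s \<gamma>' t)) (at t)"
    proof (rule has_derivative_componentwise_within[THEN iffD2], rule ballI)
      fix e :: "complex ^ 'a" assume "e \<in> Basis"
      then obtain i c where e: "e = axis i c" by (auto simp: Basis_vec_def)
      have "((\<lambda>t. \<gamma> t $ i) has_derivative (\<lambda>h. \<gamma>' t $ i * h)) (at t)"
        by (rule has_field_derivative_imp_has_derivative[OF \<gamma>[OF t]])
      from has_derivative_inner_left[OF this, of c]
      show "((\<lambda>t. \<gamma> t \<bullet> e) has_derivative (\<lambda>h. (h *s \<gamma>' t) \<bullet> e)) (at t)"
        by (simp add: e inner_axis mult.commute)
    qed
    from has_derivative_compose[OF this L(1)]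
    have "((\<lambda>t. f (\<gamma> t)) has_derivative (\<lambda>h. L (\<gamma>' t) * h)) (at t)"
      by (simp add: L(2) mult.commute)
    then show ?thesis by (auto simp: has_field_derivative_def)
  qed
  then show ?thesis
    unfolding holomorphic_on_def field_differentiable_def by (meson has_field_derivative_at_within)
qed

text \<open>The factor \<open>(snd y) ^ k\<close> is the Jacobian of the covering up to the constant \<open>k\<close>. It makes the pullback square
integrable with respect to Lebesgue measure on the bidisc.\<close>

lemma hartogs_pullback_reproducing:
  fixes f :: "complex ^ 2 \<Rightarrow> complex" and F :: "complex \<times> complex \<Rightarrow> complex"
  assumes k: "k \<ge> 1" and f: "f \<in> bergman_space (hartogs_domain k)"
    and u: "u \<in> ball 0 1" and v: "v \<in> ball 0 1 - {0}"
  defines "F \<equiv> \<lambda>y. snd y ^ k * f (hartogs_cover k y)"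
  shows "set_integrable lborel punctured_bidisc (\<lambda>y. F y
      * (1 / (1 - u * cnj (fst y))\<^sup>2 * (1 / (1 - v * cnj (snd y))\<^sup>2)))"
    and "(LINT y:punctured_bidisc|lborel. F y * (1 / (1 - u * cnj (fst y))\<^sup>2 * (1 / (1 - v * cnj (snd y))\<^sup>2)))
        = pi\<^sup>2 * F (u, v)"
proof -
  have hol: "holomorphic_Cn f (hartogs_domain k)" and int: "set_integrable lebesgue (hartogs_domain k) (\<lambda>w. (cmod (f w))\<^sup>2)"
    using f by (auto simp: bergman_space_def)
  have in_dom: "vector [a * b, b ^ k] \<in> hartogs_domain k" if "a \<in> ball 0 1" "b \<in> ball 0 1 - {0}" for a b
    using hartogs_cover_in[OF k, of "(a, b)"] that by (simp add: punctured_bidisc_def hartogs_cover_def)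
  have hol1: "(\<lambda>a. F (a, b)) holomorphic_on ball 0 1" if b: "b \<in> ball 0 1 - {0}" for b
  proof -
    have "(\<lambda>a. f (vector [a * b, b ^ k])) holomorphic_on ball 0 1"
    proof (rule holomorphic_Cn_compose_curve[OF hol, of _ _ "\<lambda>_. vector [b, 0]"])
      fix t and i :: 2
      show "((\<lambda>t. vector [t * b, b ^ k] $ i) has_field_derivative vector [b, 0] $ i) (at t)"
        using exhaust_2[of i] by (auto intro!: derivative_eq_intros)
    qed (use in_dom b in blast)
    then show ?thesis unfolding F_def hartogs_cover_def by (auto intro!: holomorphic_intros)
  qed
  have hol2: "(\<lambda>b. F (a, b)) holomorphic_on ball 0 1 - {0}" if a: "a \<in> ball 0 1" for a
  proof -
    have "(\<lambda>b. f (vector [a * b, b ^ k])) holomorphic_on ball 0 1 - {0}"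
    proof (rule holomorphic_Cn_compose_curve[OF hol, of _ _ "\<lambda>b. vector [a, of_nat k * b ^ (k - 1)]"])
      fix t and i :: 2
      show "((\<lambda>t. vector [a * t, t ^ k] $ i) has_field_derivative vector [a, of_nat k * t ^ (k - 1)] $ i) (at t)"
        using exhaust_2[of i] by (auto intro!: derivative_eq_intros)
    qed (use in_dom a in blast)
    then show ?thesis unfolding F_def hartogs_cover_def by (auto intro!: holomorphic_intros)
  qed
  have "continuous_on punctured_bidisc (\<lambda>y. f (hartogs_cover k y))"
    by (rule continuous_on_compose2[OF holomorphic_Cn_continuous_on[OF hol] continuous_on_hartogs_cover]) (use hartogs_cover_in[OF k] in auto)
  then have contF: "continuous_on punctured_bidisc F"
    unfolding F_def by (intro continuous_intros)
  let ?q = "\<lambda>w. indicator (hartogs_domain k) w *\<^sub>R (cmod (f w))\<^sup>2"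
  have "(\<lambda>w. (cmod (indicator (hartogs_domain k) w *\<^sub>R f w))\<^sup>2) \<in> borel_measurable borel"
    using borel_measurable_indicator_holomorphic_Cn[OF open_hartogs_domain hol] by measurable
  moreover have "(\<lambda>w. (cmod (indicator (hartogs_domain k) w *\<^sub>R f w))\<^sup>2) = ?q"
    by (auto simp: indicator_def)
  ultimately have meas: "?q \<in> borel_measurable borel" by (simp only:)
  have "set_integrable lborel (hartogs_domain k) (\<lambda>w. (cmod (f w))\<^sup>2)"
    using int by (subst (asm) set_integrable_lebesgue_iff_lborel(1)[OF meas])
  also have "?this \<longleftrightarrow> set_integrable lborel (hartogs_domain k) ?q"
    by (intro set_integrable_cong) simp_all
  finally have "set_integrable lborel (hartogs_domain k) ?q" .
  then have "set_integrable lborel punctured_bidisc (\<lambda>y. (real k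
      * cmod (snd y) ^ (2 * k)) *\<^sub>R ?q (hartogs_cover k y))"
    by (subst (asm) set_integrable_hartogs_cover[OF meas k])
  then have "set_integrable lborel punctured_bidisc (\<lambda>y. (1 / real k)
      * ((real k * cmod (snd y) ^ (2 * k)) *\<^sub>R ?q (hartogs_cover k y)))"
    by (rule set_integrable_mult_right)
  also have "?this \<longleftrightarrow> set_integrable lborel punctured_bidisc (\<lambda>y. (cmod (F y))\<^sup>2)"
    using k hartogs_cover_in[OF k]
    by (intro set_integrable_cong refl) (simp add: F_def norm_mult norm_power power_mult_distrib power_mult[symmetric] mult.commute)
  finally have int2: "set_integrable lborel punctured_bidisc (\<lambda>y. (cmod (F y))\<^sup>2)" .
  show "set_integrable lborel punctured_bidisc (\<lambda>y. F y
      * (1 / (1 - u * cnj (fst y))\<^sup>2 * (1 / (1 - v * cnj (snd y))\<^sup>2)))"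
    and "(LINT y:punctured_bidisc|lborel. F y * (1 / (1 - u * cnj (fst y))\<^sup>2 * (1 / (1 - v * cnj (snd y))\<^sup>2)))
        = pi\<^sup>2 * F (u, v)"
    by (rule punctured_bidisc_bergman_reproducing[OF contF hol1 hol2 int2 u v]; assumption)+
qed

text \<open>After the change of variables each \<open>\<omega>\<close> contributes the reproducing formula of the bidisc at the point
\<open>(\<omega> u, v / \<omega>)\<close>. This is a point of the same fibre as \<open>(u, v)\<close>, where \<open>F\<close> takes the same value, so all \<open>k\<close>
contributions are equal.\<close>

lemma hartogs_kernel_reproducing:
  assumes k: "k \<ge> 1" and x: "x \<in> punctured_bidisc" and f: "f \<in> bergman_space (hartogs_domain k)"
  shows "f (hartogs_cover k x) = (LINT w:hartogs_domain k|lebesgue. hartogs_kernel k x w * f w)"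
proof -
  obtain u v where uv: "x = (u, v)" by (cases x)
  have u: "u \<in> ball 0 1" and v: "v \<in> ball 0 1 - {0}" using x by (auto simp: uv punctured_bidisc_def)
  have v0: "v \<noteq> 0" using v by simp
  let ?H = "hartogs_domain k" and ?B = punctured_bidisc and ?R = "roots_of_unity k"
  have hol: "holomorphic_Cn f ?H" using f by (auto simp: bergman_space_def)
  define \<Phi> where "\<Phi> w = indicator ?H w *\<^sub>R (hartogs_kernel k x w * f w)" for w
  have meas: "\<Phi> \<in> borel_measurable borel"
  proof -
    have mf: "(\<lambda>w. indicator ?H w *\<^sub>R f w) \<in> borel_measurable borel"
      by (rule borel_measurable_indicator_holomorphic_Cn[OF open_hartogs_domain hol])
    have mg: "(\<lambda>w. indicator ?H w *\<^sub>R cnj (hartogs_kernel k x w)) \<in> borel_measurable borel"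
      by (rule borel_measurable_indicator_holomorphic_Cn[OF open_hartogs_domain holomorphic_Cn_cnj_hartogs_kernel[OF k x]])
    have "(\<lambda>w. cnj (indicator ?H w *\<^sub>R cnj (hartogs_kernel k x w))
        * (indicator ?H w *\<^sub>R f w)) \<in> borel_measurable borel"
      using mf mg by (intro borel_measurable_times measurable_compose[OF mg borel_measurable_continuous_onI]) (auto intro!: continuous_intros)
    moreover have "(\<lambda>w. cnj (indicator ?H w *\<^sub>R cnj (hartogs_kernel k x w)) * (indicator ?H w *\<^sub>R f w))
        = \<Phi>"
      by (auto simp: indicator_def \<Phi>_def)
    ultimately show ?thesis by (simp only:)
  qed
  define F where "F y = snd y ^ k * f (hartogs_cover k y)" for y
  define T where "T \<omega> y
      = F y * (1 / (1 - \<omega> * u * cnj (fst y))\<^sup>2 * (1 / (1 - v / \<omega> * cnj (snd y))\<^sup>2))" for \<omega> y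
  have \<omega>uv: "\<omega> * u \<in> ball 0 1" "v / \<omega> \<in> ball 0 1 - {0}" "F (\<omega> * u, v / \<omega>) = F (u, v)" if "\<omega> \<in> ?R" for \<omega>
  proof -
    have \<omega>: "cmod \<omega> = 1" by (rule norm_root_of_unity[OF k that])
    then show "\<omega> * u \<in> ball 0 1" "v / \<omega> \<in> ball 0 1 - {0}" using u v by (auto simp: norm_mult norm_divide)
    have "\<omega> \<noteq> 0" using \<omega> by auto
    then show "F (\<omega> * u, v / \<omega>) = F (u, v)"
      using that by (simp add: F_def hartogs_cover_def roots_of_unity_def power_divide)
  qed
  have Tint: "set_integrable lborel ?B (T \<omega>)" and Tval: "(LINT y:?B|lborel. T \<omega> y) = pi\<^sup>2 * F (u, v)" if "\<omega> \<in> ?R" for \<omega>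
    using hartogs_pullback_reproducing[OF k f \<omega>uv(1,2)[OF that]] \<omega>uv(3)[OF that]
    unfolding T_def F_def by simp_all
  have "(LINT w:?H|lebesgue. hartogs_kernel k x w * f w) = (LINT w:?H|lborel. hartogs_kernel k x w * f w)"
    by (rule set_integrable_lebesgue_iff_lborel(2)) (use meas in \<open>simp add: \<Phi>_def[abs_def]\<close>)
  also have "\<dots> = (LINT w:?H|lborel. \<Phi> w)"
    by (simp add: set_lebesgue_integral_def \<Phi>_def indicator_inter_arith[symmetric])
  also have "\<dots> = (LINT y:?B|lborel. (real k * cmod (snd y) ^ (2 * k)) *\<^sub>R \<Phi> (hartogs_cover k y))"
    by (rule set_integral_hartogs_cover[OF meas k])
  also have "\<dots> = (LINT y:?B|lborel. 1 / (of_nat k * of_real pi ^ 2 * v ^ k) * (\<Sum>\<omega>\<in>?R. T \<omega> y))"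
  proof (rule set_lebesgue_integral_cong)
    show "\<forall>y. y \<in> ?B \<longrightarrow> (real k * cmod (snd y) ^ (2 * k)) *\<^sub>R \<Phi> (hartogs_cover k y)
        = 1 / (of_nat k * of_real pi ^ 2 * v ^ k) * (\<Sum>\<omega>\<in>?R. T \<omega> y)"
    proof (intro allI impI)
      fix y assume y: "y \<in> ?B"
      have y0: "snd y \<noteq> 0" using y by (auto simp: punctured_bidisc_def)
      define S where "S
          = (\<Sum>\<omega>\<in>?R. 1 / (1 - \<omega> * u * cnj (fst y))\<^sup>2 * (1 / (1 - v / \<omega> * cnj (snd y))\<^sup>2))"
      have "complex_of_real (cmod (snd y) ^ (2 * k)) = snd y ^ k * cnj (snd y) ^ k"
        by (simp only: power_mult of_real_power complex_norm_square[unfolded of_real_power] power_mult_distrib)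
      moreover have "\<Phi> (hartogs_cover k y)
          = S / (of_nat k ^ 2 * of_real pi ^ 2 * (v * cnj (snd y)) ^ k) * f (hartogs_cover k y)"
        using hartogs_cover_in[OF k y] by (simp add: \<Phi>_def hartogs_kernel_cover[OF k y] hartogs_cover_kernel_def S_def uv)
      ultimately have "(real k * cmod (snd y) ^ (2 * k)) *\<^sub>R \<Phi> (hartogs_cover k y)
          = 1 / (of_nat k * of_real pi ^ 2 * v ^ k) * (F y * S)"
        using k y0 v0 by (simp add: scaleR_conv_of_real F_def power_mult_distrib power2_eq_square field_simps)
      then show "(real k * cmod (snd y) ^ (2 * k)) *\<^sub>R \<Phi> (hartogs_cover k y)
          = 1 / (of_nat k * of_real pi ^ 2 * v ^ k) * (\<Sum>\<omega>\<in>?R. T \<omega> y)"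
        by (simp only: S_def T_def sum_distrib_left)
    qed
  qed simp
  also have "\<dots> = 1 / (of_nat k * of_real pi ^ 2 * v ^ k) * (LINT y:?B|lborel. (\<Sum>\<omega>\<in>?R. T \<omega> y))"
    by (rule set_integral_mult_right)
  also have "(LINT y:?B|lborel. (\<Sum>\<omega>\<in>?R. T \<omega> y))
      = (\<Sum>\<omega>\<in>?R. (LINT y:?B|lborel. T \<omega> y))"
    unfolding set_lebesgue_integral_def scaleR_sum_right
    using Tint by (intro Bochner_Integration.integral_sum) (simp add: set_integrable_def)
  also have "\<dots> = of_nat k * (pi\<^sup>2 * F (u, v))"
    by (simp add: Tval card_roots_of_unity[OF k])
  also have "1 / (of_nat k * of_real pi ^ 2 * v ^ k) * (of_nat k * (pi\<^sup>2 * F (u, v))) = f (hartogs_cover k x)"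
    using k v0 by (simp add: F_def uv)
  finally show ?thesis by simp
qed

theorem bergman_kernel_hartogs_domain:
  assumes k: "k \<ge> 1" and x: "x \<in> punctured_bidisc" and y: "y \<in> punctured_bidisc"
  shows "bergman_kernel (hartogs_domain k) (hartogs_cover k x) (hartogs_cover k y) = hartogs_cover_kernel k x y"
proof -
  have "bergman_kernel (hartogs_domain k) (hartogs_cover k x) = hartogs_kernel k x"
    using cnj_hartogs_kernel_in_bergman_space[OF k x] hartogs_kernel_reproducing[OF k x]
    by (intro bergman_kernel_eqI open_hartogs_domain) (simp_all add: hartogs_kernel_def)
  then show ?thesis by (simp add: hartogs_kernel_cover[OF k y])
qed

section \<open>Zeros of the Bergman kernel\<close>

text \<open>If \<open>k\<close> does not divide \<open>m\<close>, multiplication by a primitive root permutes the terms and scales the sum by a factor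
other than \<open>1\<close>.\<close>

lemma sum_roots_of_unity_power:
  assumes k: "k \<ge> 1"
  shows "(\<Sum>\<omega>\<in>roots_of_unity k. \<omega> ^ m) = (if k dvd m then of_nat k else 0)"
proof (cases "k dvd m")
  case True
  then obtain j where "m = k * j" by blast
  then have "(\<Sum>\<omega>\<in>roots_of_unity k. \<omega> ^ m) = (\<Sum>\<omega>\<in>roots_of_unity k. 1)"
    by (intro sum.cong) (auto simp: roots_of_unity_def power_mult)
  then show ?thesis using True by (simp add: card_roots_of_unity[OF k])
next
  case False
  define \<eta> where "\<eta> = cis (2 * pi / real k)"
  have "real k * (2 * pi / real k) = 2 * pi" using k by simp
  then have "\<eta> ^ k = 1" using Complex.DeMoivre[of "2 * pi / real k" k] by (simp only: \<eta>_def cis_2pi)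
  then have \<eta>: "\<eta> \<in> roots_of_unity k" "\<eta> \<noteq> 0" by (auto simp: \<eta>_def roots_of_unity_def)
  have "\<eta> ^ m \<noteq> 1"
  proof
    assume "\<eta> ^ m = 1"
    then have "cis (2 * pi * real m / real k) = 1" by (simp add: \<eta>_def Complex.DeMoivre mult_ac)
    then obtain n :: int where "2 * pi * real m / real k = of_int n * (2 * pi)"
      by (auto simp: complex_eq_iff cos_one_2pi_int)
    then have "real m = of_int n * real k" using k by (simp add: field_simps)
    then have "int m = n * int k" by (metis of_int_eq_iff of_int_mult of_int_of_nat_eq)
    then have "int k dvd int m" by simp
    with False show False by simp
  qed
  have "(\<Sum>\<omega>\<in>roots_of_unity k. \<omega> ^ m) = (\<Sum>\<omega>\<in>roots_of_unity k. (\<omega> * \<eta>) ^ m)"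
  proof (rule sum.reindex_bij_witness[of _ "\<lambda>\<omega>. \<omega> * \<eta>" "\<lambda>\<omega>. \<omega> / \<eta>"])
  qed (use \<eta> in \<open>auto simp: roots_of_unity_def power_divide power_mult_distrib\<close>)
  also have "\<dots> = \<eta> ^ m * (\<Sum>\<omega>\<in>roots_of_unity k. \<omega> ^ m)"
    by (simp add: power_mult_distrib sum_distrib_left mult.commute)
  finally show ?thesis using \<open>\<eta> ^ m \<noteq> 1\<close> False by (metis mult_cancel_right1)
qed

text \<open>Since \<open>1 / (1 - \<omega> y)\<close> is the finite geometric sum of \<open>(\<omega> y) ^ i\<close> over \<open>i < k\<close> divided by \<open>1 - y ^ k\<close>, its square
is a double sum in which averaging over \<open>\<omega>\<close> keeps only the exponents \<open>i + j = 0\<close>, which occurs once, and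
\<open>i + j = k\<close>, which occurs \<open>k - 1\<close> times.\<close>

lemma sum_roots_of_unity_double_pole:
  assumes k: "k \<ge> 1" and y: "y ^ k \<noteq> 1"
  shows "(\<Sum>\<omega>\<in>roots_of_unity k. 1 / (1 - \<omega> * y)\<^sup>2)
      = of_nat k * (1 + (of_nat k - 1) * y ^ k) / (1 - y ^ k)\<^sup>2"
proof -
  have geo: "1 / (1 - \<omega> * y)\<^sup>2 = (\<Sum>i<k. \<Sum>j<k. \<omega> ^ (i + j) * y ^ (i + j)) / (1 - y ^ k)\<^sup>2" if "\<omega> \<in> roots_of_unity k" for \<omega>
  proof -
    have p: "(\<omega> * y) ^ k = y ^ k" using that by (simp add: roots_of_unity_def power_mult_distrib)
    then have ne: "\<omega> * y \<noteq> 1" using y by auto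
    have "(1 - \<omega> * y) * (\<Sum>i<k. (\<omega> * y) ^ i) = 1 - y ^ k"
      using one_diff_power_eq[of "\<omega> * y" k] p by simp
    then have "1 / (1 - \<omega> * y) = (\<Sum>i<k. (\<omega> * y) ^ i) / (1 - y ^ k)"
      using ne y by (simp add: field_simps)
    then have "1 / (1 - \<omega> * y)\<^sup>2 = (\<Sum>i<k. (\<omega> * y) ^ i)\<^sup>2 / (1 - y ^ k)\<^sup>2"
      by (metis power_divide power_one)
    moreover have "(\<Sum>i<k. (\<omega> * y) ^ i)\<^sup>2 = (\<Sum>i<k. \<Sum>j<k. \<omega> ^ (i + j) * y ^ (i + j))"
      by (simp add: power2_eq_square sum_product power_add power_mult_distrib mult_ac)
    ultimately show ?thesis by simp
  qed
  have inner: "(\<Sum>\<omega>\<in>roots_of_unity k. \<omega> ^ (i + j) * y ^ (i + j))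
      = (if i = 0 \<and> j = 0 then of_nat k else if i + j = k then of_nat k * y ^ k else 0)"
    if "i < k" "j < k" for i j
  proof -
    have "k dvd i + j \<longleftrightarrow> i + j = 0 \<or> i + j = k"
    proof
      assume "k dvd i + j"
      then obtain q where q: "i + j = k * q" by blast
      then have "k * q < k * 2" using that by linarith
      then have "q < 2" by simp
      then show "i + j = 0 \<or> i + j = k" using q by (cases "q = 0") (auto simp: less_2_cases_iff)
    qed auto
    then show ?thesis
      unfolding sum_distrib_right[symmetric] sum_roots_of_unity_power[OF k] using k by auto
  qed
  have row: "(\<Sum>j<k. if i = 0 \<and> j = 0 then of_nat k else if i + j = k then of_nat k * y ^ k else 0)
      = (if i = 0 then of_nat k else of_nat k * y ^ k)"
    if "i < k" for i
  proof (cases "i = 0")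
    case True
    then have "(\<Sum>j<k. if i = 0 \<and> j = 0 then of_nat k else if i + j = k then of_nat k * y ^ k else 0)
        = (\<Sum>j<k. if j = 0 then of_nat k else 0)"
      by (intro sum.cong) auto
    then show ?thesis using True k by simp
  next
    case False
    then have "(\<Sum>j<k. if i = 0 \<and> j = 0 then of_nat k else if i + j = k then of_nat k * y ^ k else 0)
        = (\<Sum>j<k. if j = k - i then of_nat k * y ^ k else 0)"
      using that by (intro sum.cong) auto
    then show ?thesis using False that by simp
  qed
  have "(\<Sum>\<omega>\<in>roots_of_unity k. 1 / (1 - \<omega> * y)\<^sup>2)
      = (\<Sum>\<omega>\<in>roots_of_unity k. \<Sum>i<k. \<Sum>j<k. \<omega> ^ (i + j) * y ^ (i + j)) / (1 - y ^ k)\<^sup>2"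
    by (simp add: geo sum_divide_distrib)
  also have "(\<Sum>\<omega>\<in>roots_of_unity k. \<Sum>i<k. \<Sum>j<k. \<omega> ^ (i + j) * y ^ (i + j))
      = (\<Sum>i<k. \<Sum>j<k. \<Sum>\<omega>\<in>roots_of_unity k. \<omega> ^ (i + j) * y ^ (i + j))"
    by (subst sum.swap, intro sum.cong refl, rule sum.swap)
  also have "\<dots> = (\<Sum>i<k. if i = 0 then of_nat k else of_nat k * y ^ k)"
    by (simp add: inner row)
  also have "\<dots> = (\<Sum>i<k. (if i = 0 then of_nat k - of_nat k * y ^ k else 0) + of_nat k * y ^ k)"
    by (intro sum.cong) auto
  also have "\<dots> = of_nat k * (1 + (of_nat k - 1) * y ^ k)"
    using k by (simp add: sum.distrib algebra_simps)
  finally show ?thesis .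
qed


theorem corollary4p2:
  fixes k :: nat
  assumes "k \<ge> 2"
  shows "\<not> lu_qi_keng (hartogs_domain k)"
proof -
  have k: "k \<ge> 1" using assms by simp
  have "\<exists>x\<in>punctured_bidisc. \<exists>y\<in>punctured_bidisc. hartogs_cover_kernel k x y = 0"
  proof (cases "k = 2")
    case True
    have R: "roots_of_unity 2 = {1, - 1}" by (auto simp: roots_of_unity_def power2_eq_1_iff)
    \<comment> \<open>Here \<open>u cnj a = \<i> / 3\<close> and \<open>v cnj b = \<i> / 2\<close>, for which the terms of \<open>\<omega> = 1\<close> and \<open>\<omega> = -1\<close> are opposite.\<close>
    have "hartogs_cover_kernel k (2 * \<i> / 3, 2 * \<i> / 3) (1 / 2, 3 / 4) = 0"
      by (simp add: True hartogs_cover_kernel_def R power2_eq_square complex_eq_iff Re_divide Im_divide)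
    moreover have "(2 * \<i> / 3, 2 * \<i> / 3) \<in> punctured_bidisc" "(1 / 2, 3 / 4) \<in> punctured_bidisc"
      by (auto simp: punctured_bidisc_def norm_mult norm_divide)
    ultimately show ?thesis by blast
  next
    case False
    then have k3: "k \<ge> 3" using assms by simp
    \<comment> \<open>\<open>r e\<close> is a solution of \<open>t ^ k = - 1 / (k - 1)\<close>; it is split as a product of two points of the punctured disc.\<close>
    define r where "r = root k (1 / (real k - 1))"
    have r: "0 < r" "r ^ k = 1 / (real k - 1)" using k3 by (simp_all add: r_def)
    have "r ^ k < 1 ^ k" using k3 by (simp add: r)
    then have r1: "r < 1" using r power_less_imp_less_base[of r k 1] by simp
    define e where "e = cis (pi / real k)"
    have "real k * (pi / real k) = pi" using k3 by simp
    then have e: "e ^ k = - 1" using Complex.DeMoivre[of "pi / real k" k] by (simp only: e_def cis_pi)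
    define s where "s = sqrt r"
    have s: "0 < s" "s < 1" "s * s = r" using r r1 by (simp_all add: s_def)
    define x where "x = (0 :: complex, of_real s * e)"
    define y where "y = (0 :: complex, complex_of_real s)"
    have mem: "x \<in> punctured_bidisc" "y \<in> punctured_bidisc"
      using s by (auto simp: x_def y_def punctured_bidisc_def norm_mult e_def)
    define t where "t = snd x * cnj (snd y)"
    have t: "t = of_real r * e" using s(3) by (simp add: t_def x_def y_def flip: of_real_mult)
    have tk: "t ^ k = - 1 / (of_nat k - 1)"
    proof -
      have "t ^ k = of_real (r ^ k) * e ^ k" by (simp add: t power_mult_distrib)
      then show ?thesis unfolding r(2) e by simp
    qed
    have "t ^ k \<noteq> 1"
    proof
      assume "t ^ k = 1"
      then have "cmod t ^ k = 1" by (metis norm_one norm_power)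
      moreover have "cmod t = r" using r by (simp add: t norm_mult e_def)
      ultimately show False using \<open>r ^ k < 1 ^ k\<close> by simp
    qed
    have "(\<Sum>\<omega>\<in>roots_of_unity k. 1 / (1 - \<omega> * fst x * cnj (fst y))\<^sup>2 * (1 / (1 - snd x / \<omega> * cnj (snd y))\<^sup>2))
      = (\<Sum>\<omega>\<in>roots_of_unity k. 1 / (1 - \<omega> * t)\<^sup>2)"
    proof (rule sum.reindex_bij_witness[of _ "\<lambda>\<omega>. 1 / \<omega>" "\<lambda>\<omega>. 1 / \<omega>"])
    qed (auto simp: roots_of_unity_def power_divide x_def y_def t_def)
    also have "\<dots> = 0"
      unfolding sum_roots_of_unity_double_pole[OF k \<open>t ^ k \<noteq> 1\<close>] tk using k3 by simp
    finally have "hartogs_cover_kernel k x y = 0" by (simp add: hartogs_cover_kernel_def)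
    with mem show ?thesis by blast
  qed
  then obtain x y where xy: "x \<in> punctured_bidisc" "y \<in> punctured_bidisc" and "hartogs_cover_kernel k x y = 0"
    by blast
  then have "bergman_kernel (hartogs_domain k) (hartogs_cover k x) (hartogs_cover k y) = 0"
    by (simp add: bergman_kernel_hartogs_domain[OF k xy])
  then show ?thesis
    using hartogs_cover_in[OF k xy(1)] hartogs_cover_in[OF k xy(2)] unfolding lu_qi_keng_def by blast
qed

end
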